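(* Let $1\le p\le\infty$, let $A, E\in\mathbb{C}^{m\times n}$ with $A\ne 0$, let $r=\operatorname{rank}(E)$, and suppose $\epsilon = \|E\|_2/\|A\|_2 < 1$. Then $$\frac{1}{1+\epsilon}\left(\sqrt[p]{\operatorname{sr}_p(A)} - \sqrt[p]{r}\,\epsilon\right) \le \sqrt[p]{\operatorname{sr}_p(A+E)} \le \frac{1}{1-\epsilon}\left(\sqrt[p]{\operatorname{sr}_p(A)} + \sqrt[p]{r}\,\epsilon\right).$$ If, in addition, $A, E\in\mathbb{C}^{n\times n}$ are Hermitian positive semi-definite, then $$\frac{\sqrt[p]{\operatorname{sr}_p(A)}}{1+\epsilon} \le \sqrt[p]{\operatorname{sr}_p(A+E)} \le \sqrt[p]{\operatorname{sr}_p(A)} + \sqrt[p]{r}\,\epsilon.$$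
   Context: For $A\in\mathbb{C}^{m\times n}$ with singular values $\sigma_1(A)\ge\cdots\ge\sigma_{\min\{m,n\}}(A)\ge 0$, the Schatten $p$-norm is $\|A\|_{(p)} = \left(\sum_{j}\sigma_j(A)^p\right)^{1/p}$ for $1\le p<\infty$, and $\|A\|_{(\infty)}=\sigma_1(A)=\|A\|_2$ is the operator two-norm. For $1\le p\le\infty$ the $p$-stable rank of a non-zero matrix $A$ is $\operatorname{sr}_p(A) = \|A\|_{(p)}^p/\|A\|_2^p$, with $\operatorname{sr}_\infty(A)=1$; for the zero matrix, $\operatorname{sr}_p(0)=0$. For non-zero $A$, $\sqrt[p]{\operatorname{sr}_p(A)}=\|A\|_{(p)}/\|A\|_2$; for $p=\infty$ the $p$-th root is understood in this sense, so it equals $1$, and likewise $\sqrt[\infty]{r}=1$ for $r\ge 1$ (if $r=0$ then $E=0$ and $\epsilon=0$, so the term $\sqrt[p]{r}\,\epsilon$ is $0$). *)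

theory Defs
  imports
    "HOL-Analysis.L2_Norm"
    "HOL-Library.Extended_Real"
    "HOL-Computational_Algebra.Fundamental_Theorem_Algebra"
    "Jordan_Normal_Form.Schur_Decomposition"
    "Jordan_Normal_Form.DL_Rank"
begin

definition vec_norm2 :: "complex vec \<Rightarrow> real" where
  "vec_norm2 v = L2_set (\<lambda>i. cmod (v $ i)) {..<dim_vec v}"

definition op_norm2 :: "complex mat \<Rightarrow> real" where
  "op_norm2 A =
     (SUP v \<in> {v \<in> carrier_vec (dim_col A). vec_norm2 v \<le> 1}. vec_norm2 (A *\<^sub>v v))"

(* The square roots of the eigenvalues of A^*A (with algebraic multiplicity), in descending
   order.  A^*A has dim_col A eigenvalues, all real and non-negative; if dim_row A < dim_col A,
   the entries cut off by take are zeros. *)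
definition singular_values :: "complex mat \<Rightarrow> real list" where
  "singular_values A =
     take (min (dim_row A) (dim_col A))
       (rev (sorted_list_of_multiset
          (image_mset (\<lambda>z. sqrt (Re z)) (proots (char_poly (mat_adjoint A * A))))))"

(* Matrices without rows or columns have no singular values and get norm 0. *)
definition schatten_norm :: "ereal \<Rightarrow> complex mat \<Rightarrow> real" where
  "schatten_norm p A =
     (if p = \<infinity> then (case singular_values A of [] \<Rightarrow> 0 | s # _ \<Rightarrow> s)
      else (\<Sum>s\<leftarrow>singular_values A. s powr real_of_ereal p) powr (1 / real_of_ereal p))"

definition stable_rank :: "ereal \<Rightarrow> complex mat \<Rightarrow> real" where
  "stable_rank p A =
     (if A = 0\<^sub>m (dim_row A) (dim_col A) then 0
      else if p = \<infinity> then 1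
      else schatten_norm p A powr real_of_ereal p / op_norm2 A powr real_of_ereal p)"

(* The p-th root of a non-negative real x; for p = \<infinity> it is only meant for x = 0 and x \<ge> 1,
   where it is 0 and 1, respectively. *)
definition proot :: "ereal \<Rightarrow> real \<Rightarrow> real" where
  "proot p x = (if p = \<infinity> then (if x = 0 then 0 else 1) else x powr (1 / real_of_ereal p))"

(* The order on complex numbers is that of Complex_Order: 0 \<le> z means that z is real and
   non-negative. *)
definition hermitian_psd :: "complex mat \<Rightarrow> bool" where
  "hermitian_psd A \<longleftrightarrow>
     square_mat A \<and> mat_adjoint A = A \<and>
     (\<forall>v \<in> carrier_vec (dim_row A). 0 \<le> (A *\<^sub>v v) \<bullet>c v)"

end

theory Submission
  imports Defs "HOL-Analysis.Convex"
begin

text \<open>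
  Everything rests on one inequality: if \<open>u\<^sub>i\<close> and \<open>v\<^sub>i\<close> are orthonormal families, then
  \<open>\<Sum>\<^sub>i \<bar>\<langle>A v\<^sub>i, u\<^sub>i\<rangle>\<bar>\<^sup>p \<le> \<Sum>\<^sub>j \<sigma>\<^sub>j(A)\<^sup>p\<close>. Indeed, for a singular value decomposition
  \<open>A = \<Sum>\<^sub>j \<sigma>\<^sub>j x\<^sub>j y\<^sub>j\<^sup>*\<close>, the left-hand pairing is at most \<open>\<Sum>\<^sub>j w\<^sub>i\<^sub>j \<sigma>\<^sub>j\<close> with
  \<open>w\<^sub>i\<^sub>j = (\<bar>\<langle>x\<^sub>j, u\<^sub>i\<rangle>\<bar>\<^sup>2 + \<bar>\<langle>v\<^sub>i, y\<^sub>j\<rangle>\<bar>\<^sup>2) / 2\<close>, and by Bessel's inequality all row and column sums of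
  \<open>w\<close> are at most 1, so Jensen's inequality applies. Pairing against the singular vectors of
  \<open>A + E\<close> and using Minkowski's inequality for sums gives the triangle inequality of the Schatten
  norm; pairing \<open>A + E\<close> against the eigenvectors of \<open>A\<close> gives monotonicity in the positive
  semi-definite case. Since \<open>E\<close> has at most \<open>r\<close> non-zero singular values, its Schatten norm is at
  most \<open>r powr (1 / p)\<close> times its operator norm, and the bounds follow by dividing by the operator
  norms. For \<open>p = \<infinity>\<close> all roots of stable ranks are 1.
\<close>

section \<open>Power sums\<close>

text \<open>The graph of a convex power lies above its tangent at \<open>c\<close>. Scaling by
  \<open>c\<close> reduces this to Bernoulli's inequality
  \<open>1 + p * (y - 1) \<le> y powr p\<close>, which is a case of Young's inequality.\<close>

lemma powr_tangent_ineq: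
  fixes x c p :: real
  assumes "p \<ge> 1" "x \<ge> 0" "c > 0"
  shows "c powr p + p * c powr (p - 1) * (x - c) \<le> x powr p"
proof (cases "x = 0")
  case True
  have "c powr p = c powr (p - 1) * c"
    using assms by (simp add: powr_diff)
  moreover have "1 * c powr p \<le> p * c powr p"
    using assms by (intro mult_right_mono) auto
  ultimately show ?thesis
    using True assms by (simp add: mult.assoc)
next
  case False
  define y where "y = x / c"
  have y: "y > 0" "x = c * y"
    using False assms by (auto simp: y_def)
  \<comment> \<open>Young's inequality for the numbers \<open>y powr p\<close> and 1 with weights
    \<open>1 / p\<close> and \<open>1 - 1 / p\<close>.\<close>
  have "(y powr p) powr (1 / p) * 1 powr (1 - 1 / p) \<le> 1 / p * y powr p + (1 - 1 / p) * 1"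
    using assms y by (intro Youngs_inequality_0) auto
  then have "y \<le> 1 / p * y powr p + 1 - 1 / p"
    using assms y by (simp add: powr_powr)
  then have "p * y \<le> p * (1 / p * y powr p + 1 - 1 / p)"
    using assms by (intro mult_left_mono) auto
  also have "\<dots> = y powr p + p - 1"
    using assms by (simp add: distrib_left right_diff_distrib)
  finally have "1 + p * (y - 1) \<le> y powr p"
    by (simp add: right_diff_distrib)
  then have "c powr p * (1 + p * (y - 1)) \<le> c powr p * y powr p"
    by (intro mult_left_mono) auto
  also have "\<dots> = x powr p"
    using y assms by (simp add: powr_mult)
  also have "c powr p * (1 + p * (y - 1)) = c powr p + p * c powr (p - 1) * (x - c)"
    using assms by (simp add: y powr_diff field_simps)
  finally show ?thesis .
qed

text \<open>Jensen's inequality for weights of total mass at most 1: average the tangent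
  inequalities at the point \<open>c = (\<Sum>j\<in>J. w j * s j)\<close>. Mass below 1 does no harm
  because the power vanishes at 0.\<close>

lemma powr_jensen_subprob:
  fixes s w :: "'a \<Rightarrow> real"
  assumes "p \<ge> 1" and s: "\<And>j. j \<in> J \<Longrightarrow> s j \<ge> 0" and w: "\<And>j. j \<in> J \<Longrightarrow> w j \<ge> 0"
    and sum_w: "sum w J \<le> 1"
  shows "(\<Sum>j\<in>J. w j * s j) powr p \<le> (\<Sum>j\<in>J. w j * s j powr p)"
proof -
  define c where "c = (\<Sum>j\<in>J. w j * s j)"
  have "c \<ge> 0"
    using s w by (auto simp: c_def intro!: sum_nonneg)
  show ?thesis
  proof (cases "c = 0")
    case True
    then show ?thesis
      using w by (simp add: c_def[symmetric] sum_nonneg)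
  next
    case False
    with \<open>c \<ge> 0\<close> have c: "c > 0" by simp
    have cp: "c powr (p - 1) * c = c powr p"
      using c by (simp add: powr_diff)
    \<comment> \<open>This is exactly the amount by which the weighted sum of the tangent values at
      \<open>c\<close> exceeds \<open>c powr p\<close>.\<close>
    have "0 \<le> (p - 1) * (1 - sum w J) * c powr p"
      using assms by simp
    also have "\<dots> = c powr p * sum w J + p * c powr (p - 1) * (c - c * sum w J) - c powr p"
      by (simp add: algebra_simps flip: cp)
    finally have "c powr p \<le> c powr p * sum w J + p * c powr (p - 1) * (c - c * sum w J)"
      by simp
    also have "\<dots> = (\<Sum>j\<in>J. c powr p * w j + p * c powr (p - 1) * (w j * s j - c * w j))"
      by (simp only: sum.distrib sum_subtractf flip: sum_distrib_left c_def)
    also have "\<dots> = (\<Sum>j\<in>J. w j * (c powr p + p * c powr (p - 1) * (s j - c)))"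
      by (simp add: algebra_simps)
    also have "\<dots> \<le> (\<Sum>j\<in>J. w j * s j powr p)"
      using assms c by (intro sum_mono mult_left_mono powr_tangent_ineq) auto
    finally show ?thesis
      by (simp add: c_def)
  qed
qed

text \<open>The row sums allow Jensen's inequality for each \<open>i\<close>; after exchanging the
  two sums, the column sums bound the total weight of each \<open>s j powr p\<close>.\<close>

lemma powr_sum_substochastic:
  fixes s :: "'b \<Rightarrow> real" and w :: "'a \<Rightarrow> 'b \<Rightarrow> real"
  assumes "p \<ge> 1" and s: "\<And>j. j \<in> J \<Longrightarrow> s j \<ge> 0"
    and w: "\<And>i j. i \<in> I \<Longrightarrow> j \<in> J \<Longrightarrow> w i j \<ge> 0"
    and row: "\<And>i. i \<in> I \<Longrightarrow> (\<Sum>j\<in>J. w i j) \<le> 1"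
    and col: "\<And>j. j \<in> J \<Longrightarrow> (\<Sum>i\<in>I. w i j) \<le> 1"
  shows "(\<Sum>i\<in>I. (\<Sum>j\<in>J. w i j * s j) powr p) \<le> (\<Sum>j\<in>J. s j powr p)"
proof -
  have "(\<Sum>i\<in>I. (\<Sum>j\<in>J. w i j * s j) powr p) \<le> (\<Sum>i\<in>I. \<Sum>j\<in>J. w i j * s j powr p)"
    using assms by (intro sum_mono powr_jensen_subprob) auto
  also have "\<dots> = (\<Sum>j\<in>J. (\<Sum>i\<in>I. w i j) * s j powr p)"
    by (subst sum.swap) (simp add: sum_distrib_right)
  also have "\<dots> \<le> (\<Sum>j\<in>J. 1 * s j powr p)"
    using col by (intro sum_mono mult_right_mono) auto
  finally show ?thesis by simp
qed

lemma powr_inverse_le_iff: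
  fixes a b p :: real
  assumes "a \<ge> 0" "b \<ge> 0" "p > 0"
  shows "a powr (1 / p) \<le> b \<longleftrightarrow> a \<le> b powr p"
proof
  assume "a powr (1 / p) \<le> b"
  then have "(a powr (1 / p)) powr p \<le> b powr p"
    using assms by (intro powr_mono2) auto
  then show "a \<le> b powr p"
    using assms by (simp add: powr_powr)
next
  assume "a \<le> b powr p"
  then have "a powr (1 / p) \<le> (b powr p) powr (1 / p)"
    using assms by (intro powr_mono2) auto
  then show "a powr (1 / p) \<le> b"
    using assms by (simp add: powr_powr)
qed

text \<open>With \<open>a\<close> and \<open>b\<close> the p-norms of \<open>f\<close> and
  \<open>g\<close>, the quotient \<open>(f i + g i) / (a + b)\<close> is a convex combination of
  \<open>f i / a\<close> and \<open>g i / b\<close>, both of p-norm 1, so convexity of the power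
  suffices. If \<open>a\<close> or \<open>b\<close> is 0, that function vanishes on
  \<open>I\<close>.\<close>

lemma Minkowski_sum_powr:
  fixes f g :: "'a \<Rightarrow> real"
  assumes "finite I" "p \<ge> 1"
    and f: "\<And>i. i \<in> I \<Longrightarrow> f i \<ge> 0" and g: "\<And>i. i \<in> I \<Longrightarrow> g i \<ge> 0"
  shows "(\<Sum>i\<in>I. (f i + g i) powr p) powr (1 / p)
           \<le> (\<Sum>i\<in>I. f i powr p) powr (1 / p) + (\<Sum>i\<in>I. g i powr p) powr (1 / p)"
proof -
  define a where "a = (\<Sum>i\<in>I. f i powr p) powr (1 / p)"
  define b where "b = (\<Sum>i\<in>I. g i powr p) powr (1 / p)"
  have ab_nonneg: "a \<ge> 0" "b \<ge> 0"
    by (auto simp: a_def b_def)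
  have a_powr: "a powr p = (\<Sum>i\<in>I. f i powr p)" and b_powr: "b powr p = (\<Sum>i\<in>I. g i powr p)"
    using assms(2) by (auto simp: a_def b_def powr_powr sum_nonneg)
  show ?thesis
  proof (cases "a = 0 \<or> b = 0")
    case True
    then show ?thesis
    proof
      assume "a = 0"
      then have "f i = 0" if "i \<in> I" for i
        using a_powr that assms(1) by (simp add: sum_nonneg_eq_0_iff)
      then show ?thesis
        using assms by simp
    next
      assume "b = 0"
      then have "g i = 0" if "i \<in> I" for i
        using b_powr that assms(1) by (simp add: sum_nonneg_eq_0_iff)
      then show ?thesis
        using assms by simp
    qed
  next
    case False
    with ab_nonneg have ab: "a > 0" "b > 0" by auto
    define t where "t = a / (a + b)"
    have t: "t \<ge> 0" "1 - t = b / (a + b)"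
      using ab by (auto simp: t_def field_simps)
    have ineq: "((f i + g i) / (a + b)) powr p \<le> t * (f i / a) powr p + (1 - t) * (g i / b) powr p"
      if "i \<in> I" for i
    proof -
      \<comment> \<open>Jensen's inequality on a two-point index set with weights \<open>t\<close>
        and \<open>1 - t\<close>.\<close>
      have "(\<Sum>j\<in>{True, False}. (if j then t else 1 - t) * (if j then f i / a else g i / b)) powr p
        \<le> (\<Sum>j\<in>{True, False}. (if j then t else 1 - t) * (if j then f i / a else g i / b) powr p)"
        using assms ab t that by (intro powr_jensen_subprob) auto
      moreover have "t * (f i / a) + (1 - t) * (g i / b) = (f i + g i) / (a + b)"
        unfolding t(2) using ab by (simp add: t_def add_divide_distrib)
      ultimately show ?thesis by simp
    qed
    have "(\<Sum>i\<in>I. (f i + g i) powr p) / (a + b) powr p = (\<Sum>i\<in>I. ((f i + g i) / (a + b)) powr p)"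
      unfolding sum_divide_distrib by (intro sum.cong refl powr_divide[symmetric])
    also have "\<dots> \<le> (\<Sum>i\<in>I. t * (f i / a) powr p + (1 - t) * (g i / b) powr p)"
      by (intro sum_mono ineq)
    also have "\<dots> = t * (\<Sum>i\<in>I. f i powr p / a powr p) + (1 - t) * (\<Sum>i\<in>I. g i powr p / b powr p)"
      unfolding sum.distrib sum_distrib_left[symmetric]
      by (simp add: powr_divide)
    also have "\<dots> = 1"
      using ab by (simp flip: sum_divide_distrib a_powr b_powr)
    finally have "(\<Sum>i\<in>I. (f i + g i) powr p) \<le> (a + b) powr p"
      using ab by (simp add: divide_le_eq)
    then show ?thesis
      unfolding a_def[symmetric] b_def[symmetric]
      using assms ab by (subst powr_inverse_le_iff) (auto intro: sum_nonneg)
  qed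
qed

text \<open>In a descending list of non-negative numbers the non-zero entries come first, so cutting
  it after \<open>k\<close> entries removes only zeros. This handles the truncation in
  \<open>singular_values\<close>.\<close>

lemma sum_list_take_descending:
  fixes M :: "real multiset" and f :: "real \<Rightarrow> 'a::comm_monoid_add"
  assumes nonneg: "\<And>x. x \<in># M \<Longrightarrow> x \<ge> 0" and size: "size {#x \<in># M. x \<noteq> 0#} \<le> k"
    and f0: "f 0 = 0"
  shows "(\<Sum>x\<leftarrow>take k (rev (sorted_list_of_multiset M)). f x) = (\<Sum>x\<in>#M. f x)"
proof -
  define L where "L = rev (sorted_list_of_multiset M)"
  have mset_L: "mset L = M"
    by (simp add: L_def)
  have sorted_L: "sorted_wrt (\<ge>) L"
    by (simp add: L_def sorted_wrt_rev)
  have "x = 0" if x: "x \<in> set (drop k L)" for x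
  \<comment> \<open>A positive entry behind position \<open>k\<close> would force all
    \<open>k\<close> earlier entries to be positive too, giving more than \<open>k\<close> non-zero
    entries.\<close>
  proof (rule ccontr)
    assume "x \<noteq> 0"
    have "x \<in># M"
      using x mset_L by (metis in_set_dropD set_mset_mset)
    with \<open>x \<noteq> 0\<close> nonneg have "x > 0" by force
    have "sorted_wrt (\<ge>) (take k L @ drop k L)"
      using sorted_L by simp
    then have "y \<ge> x" if "y \<in> set (take k L)" for y
      using that x unfolding sorted_wrt_append by blast
    with \<open>x > 0\<close> have "filter (\<lambda>x. x \<noteq> 0) (take k L) = take k L"
      by (intro filter_True) force
    moreover have "filter (\<lambda>x. x \<noteq> 0) (drop k L) \<noteq> []"
      using x \<open>x \<noteq> 0\<close> by (auto simp: filter_empty_conv)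
    moreover have "length (take k L) = k"
      using x by (cases "k \<le> length L") auto
    moreover have "filter (\<lambda>x. x \<noteq> 0) L = filter (\<lambda>x. x \<noteq> 0) (take k L) @ filter (\<lambda>x. x \<noteq> 0) (drop k L)"
      by (simp flip: filter_append)
    ultimately have "length (filter (\<lambda>x. x \<noteq> 0) L) > k"
      by simp
    moreover have "size {#x \<in># M. x \<noteq> 0#} = length (filter (\<lambda>x. x \<noteq> 0) L)"
      by (metis mset_L mset_filter size_mset)
    ultimately show False
      using size by simp
  qed
  then have "map f (drop k L) = map (\<lambda>_. 0) (drop k L)"
    using f0 by (intro map_cong) auto
  then have "(\<Sum>x\<leftarrow>drop k L. f x) = 0"
    by (simp only: sum_list_0)
  then have "(\<Sum>x\<leftarrow>take k L. f x) = (\<Sum>x\<leftarrow>take k L @ drop k L. f x)"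
    unfolding map_append sum_list_append by simp
  also have "\<dots> = (\<Sum>x\<in>#M. f x)"
    by (simp flip: sum_mset_sum_list mset_L)
  finally show ?thesis
    by (simp add: L_def)
qed

section \<open>Unitary diagonalization of Hermitian matrices\<close>

lemma mat_adjoint_dim [simp]:
  fixes A :: "complex mat"
  shows "dim_row (mat_adjoint A) = dim_col A" "dim_col (mat_adjoint A) = dim_row A"
  by (auto simp: mat_adjoint_def)

lemma mat_adjoint_index [simp]:
  fixes A :: "complex mat"
  assumes "i < dim_col A" "j < dim_row A"
  shows "mat_adjoint A $$ (i, j) = cnj (A $$ (j, i))"
  using assms by (simp add: mat_adjoint_def mat_of_rows_def)

lemma mat_adjoint_carrier:
  fixes A :: "complex mat"
  assumes "A \<in> carrier_mat m n"
  shows "mat_adjoint A \<in> carrier_mat n m"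
  using assms by (auto intro: carrier_matI)

lemma mat_adjoint_mult:
  fixes A B :: "complex mat"
  assumes "A \<in> carrier_mat m n" "B \<in> carrier_mat n k"
  shows "mat_adjoint (A * B) = mat_adjoint B * mat_adjoint A"
  using assms by (intro eq_matI) (auto simp: scalar_prod_def mult.commute)

lemma mat_adjoint_adjoint [simp]: "mat_adjoint (mat_adjoint A) = (A :: complex mat)"
  by (intro eq_matI) auto

lemma four_block_diag_adjoint:
  fixes A B :: "complex mat"
  assumes "A \<in> carrier_mat k k" "B \<in> carrier_mat n n"
  shows "mat_adjoint (four_block_mat A (0\<^sub>m k n) (0\<^sub>m n k) B)
           = four_block_mat (mat_adjoint A) (0\<^sub>m k n) (0\<^sub>m n k) (mat_adjoint B)"
  using assms by (intro eq_matI) (auto simp: not_less)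

lemma four_block_diag_mult:
  fixes A B C D :: "complex mat"
  assumes "A \<in> carrier_mat k k" "B \<in> carrier_mat n n" "C \<in> carrier_mat k k" "D \<in> carrier_mat n n"
  shows "four_block_mat A (0\<^sub>m k n) (0\<^sub>m n k) B * four_block_mat C (0\<^sub>m k n) (0\<^sub>m n k) D
           = four_block_mat (A * C) (0\<^sub>m k n) (0\<^sub>m n k) (B * D)"
  using assms by (subst mult_four_block_mat[of _ k k _ n _ n]) auto

lemma cscalar_prod_self:
  fixes v :: "complex vec"
  shows "v \<bullet>c v = of_real (\<Sum>i<dim_vec v. (cmod (v $ i))\<^sup>2)"
  by (simp add: scalar_prod_def lessThan_atLeast0 flip: complex_norm_square)

text \<open>Complete \<open>v\<close> to a basis and orthogonalize it by Gram-Schmidt, which keeps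
  the first vector; then normalize the columns.\<close>

lemma unitary_with_first_col:
  fixes v :: "complex vec"
  assumes v: "v \<in> carrier_vec n" "v \<noteq> 0\<^sub>v n"
  obtains W c where "W \<in> carrier_mat n n" "mat_adjoint W * W = 1\<^sub>m n" "col W 0 = c \<cdot>\<^sub>v v"
proof -
  interpret cof_vec_space n "TYPE(complex)" .
  define b where "b = basis_completion v"
  define ws where "ws = gram_schmidt n b"
  from basis_completion[OF v, folded b_def]
  have dist_b: "distinct b" and indep: "\<not> lin_dep (set b)" and b: "set b \<subseteq> carrier_vec n"
    and hdb: "hd b = v" and len_b: "length b = n"
    by auto
  have n: "n > 0"
    using v by (cases n) auto
  obtain vs where bv: "b = v # vs"
    using hdb len_b n by (cases b) auto
  from gram_schmidt_result[OF b dist_b indep refl, folded ws_def]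
  have ws: "set ws \<subseteq> carrier_vec n" "corthogonal ws" "length ws = n"
    by (auto simp: len_b)
  have hdws: "ws ! 0 = v"
    using gram_schmidt_hd[OF v(1), of vs, folded bv] ws(3) n by (simp add: ws_def hd_conv_nth flip: length_greater_0_conv)
  \<comment> \<open>The Gram-Schmidt vectors are orthogonal but need not be unit vectors;
    \<open>q j\<close> is the squared length of the \<open>j\<close>-th one, whose root is divided
    out in \<open>W\<close>.\<close>
  define q where "q = (\<lambda>j. \<Sum>i<n. (cmod (ws ! j $ i))\<^sup>2)"
  have dim [simp]: "dim_vec (ws ! j) = n" if "j < n" for j
    using ws that nth_mem[of j ws] by (auto simp del: nth_mem)
  have ip: "(\<Sum>i<n. ws ! j $ i * cnj (ws ! k $ i)) = (if j = k then of_real (q j) else 0)"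
    if "j < n" "k < n" for j k
  proof -
    have *: "(\<Sum>i<n. ws ! j $ i * cnj (ws ! k $ i)) = ws ! j \<bullet>c ws ! k"
      using that by (simp add: scalar_prod_def lessThan_atLeast0)
    show ?thesis
    proof (cases "j = k")
      case True
      then show ?thesis
        unfolding * using that True cscalar_prod_self[of "ws ! j"] by (simp add: q_def)
    next
      case False
      then show ?thesis
        unfolding * using corthogonalD[OF ws(2), of j k] that ws(3) by auto
    qed
  qed
  have q_pos: "q j > 0" if "j < n" for j
  proof -
    have "q j \<noteq> 0"
      using corthogonalD[OF ws(2), of j j] that ws(3) cscalar_prod_self[of "ws ! j"]
      by (auto simp: q_def simp del: of_real_sum)
    moreover have "q j \<ge> 0"
      by (simp add: q_def sum_nonneg)
    ultimately show ?thesis by linarith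
  qed
  define W where "W = mat n n (\<lambda>(i, j). ws ! j $ i / of_real (sqrt (q j)))"
  show ?thesis
  proof
    show "W \<in> carrier_mat n n"
      by (simp add: W_def)
    show "mat_adjoint W * W = 1\<^sub>m n"
    proof (rule eq_matI)
      fix j k assume jk: "j < dim_row (1\<^sub>m n :: complex mat)" "k < dim_col (1\<^sub>m n :: complex mat)"
      then have "(mat_adjoint W * W) $$ (j, k)
        = (\<Sum>i<n. ws ! k $ i * cnj (ws ! j $ i)) / (of_real (sqrt (q j)) * of_real (sqrt (q k)))"
        by (simp add: W_def scalar_prod_def lessThan_atLeast0 sum_divide_distrib mult.commute)
      also have "\<dots> = 1\<^sub>m n $$ (j, k)"
        using jk ip[of k j] q_pos[of j] q_pos[of k] by (auto simp flip: of_real_mult)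
      finally show "(mat_adjoint W * W) $$ (j, k) = 1\<^sub>m n $$ (j, k)" .
    qed (auto simp: W_def)
    show "col W 0 = (1 / of_real (sqrt (q 0))) \<cdot>\<^sub>v v"
      using n v hdws by (intro eq_vecI) (auto simp: W_def)
  qed
qed

lemma complex_eigenvector_exists:
  fixes A :: "complex mat"
  assumes "A \<in> carrier_mat n n" "n > 0"
  obtains v e where "v \<in> carrier_vec n" "v \<noteq> 0\<^sub>v n" "A *\<^sub>v v = e \<cdot>\<^sub>v v"
proof -
  have "degree (char_poly A) \<noteq> 0"
    using degree_monic_char_poly[OF assms(1)] assms(2) by simp
  then obtain e where "poly (char_poly A) e = 0"
    using fundamental_theorem_of_algebra[of "char_poly A"] constant_degree[of "char_poly A"] by auto
  then have "eigenvalue A e"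
    using eigenvalue_root_char_poly[OF assms(1)] by simp
  then show ?thesis
    using that assms(1) by (auto simp: eigenvalue_def eigenvector_def)
qed

text \<open>Deflation: conjugating by a unitary matrix whose first column is an eigenvector clears
  the first column below the corner, and by symmetry also the first row. The remaining block is
  again Hermitian and falls to the induction hypothesis.\<close>

theorem hermitian_unitary_diagonalization:
  fixes A :: "complex mat"
  assumes "A \<in> carrier_mat n n" "mat_adjoint A = A"
  shows "\<exists>U D. U \<in> carrier_mat n n \<and> D \<in> carrier_mat n n \<and> diagonal_mat D \<and>
           mat_adjoint U * U = 1\<^sub>m n \<and> mat_adjoint U * A * U = D"
  using assms
proof (induction n arbitrary: A)
  case 0
  then show ?case
    by (intro exI[of _ "1\<^sub>m 0"] exI[of _ "0\<^sub>m 0 0"]) (auto simp: diagonal_mat_def)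
next
  case (Suc n)
  let ?N = "Suc n"
  note A = Suc.prems(1)
  obtain v e where v: "v \<in> carrier_vec ?N" "v \<noteq> 0\<^sub>v ?N" "A *\<^sub>v v = e \<cdot>\<^sub>v v"
    using complex_eigenvector_exists[OF A] by auto
  obtain W c where W: "W \<in> carrier_mat ?N ?N" "mat_adjoint W * W = 1\<^sub>m ?N" "col W 0 = c \<cdot>\<^sub>v v"
    using unitary_with_first_col[OF v(1,2)] by metis
  note W' = mat_adjoint_carrier[OF W(1)]
  define B where "B = mat_adjoint W * A * W"
  have B: "B \<in> carrier_mat ?N ?N"
    using mult_carrier_mat[OF mult_carrier_mat[OF W' A] W(1)] by (simp add: B_def)
  have B_adj: "mat_adjoint B = B"
    using A W W' Suc.prems(2)
    by (simp add: B_def mat_adjoint_mult[of _ ?N ?N _ ?N] assoc_mult_mat[of _ ?N ?N _ ?N _ ?N])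
  have A_col: "A *\<^sub>v col W 0 = e \<cdot>\<^sub>v col W 0"
    using A v by (simp add: W(3) mult_mat_vec smult_smult_assoc mult.commute)
  have "col B 0 = mat_adjoint W *\<^sub>v col (A * W) 0"
    unfolding B_def assoc_mult_mat[OF W' A W(1)]
    by (rule col_mult2[OF W' mult_carrier_mat[OF A W(1)]]) simp
  also have "col (A * W) 0 = A *\<^sub>v col W 0"
    by (rule col_mult2[OF A W(1)]) simp
  also have "mat_adjoint W *\<^sub>v (A *\<^sub>v col W 0) = e \<cdot>\<^sub>v (mat_adjoint W *\<^sub>v col W 0)"
    unfolding A_col by (rule mult_mat_vec[OF W']) (use W(1) in \<open>auto intro!: carrier_vecI\<close>)
  also have "mat_adjoint W *\<^sub>v col W 0 = col (mat_adjoint W * W) 0"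
    using W(1) W' by (intro col_mult2[symmetric]) auto
  also have "\<dots> = unit_vec ?N 0"
    by (simp add: W(2))
  finally have col_B: "col B 0 = e \<cdot>\<^sub>v unit_vec ?N 0" .
  have B_col0: "B $$ (i, 0) = (if i = 0 then e else 0)" if "i < ?N" for i
    using arg_cong[OF col_B, of "\<lambda>u. u $ i"] that B by auto
  have B_row0: "B $$ (0, i) = 0" if "i < ?N" "i > 0" for i
    using B_col0[of i] that B arg_cong[OF B_adj, of "\<lambda>M. M $$ (0, i)"] by auto
  define C where "C = mat n n (\<lambda>(i, j). B $$ (Suc i, Suc j))"
  have C: "C \<in> carrier_mat n n"
    by (simp add: C_def)
  have "mat_adjoint C = C"
  proof (rule eq_matI)
    fix i j assume "i < dim_row C" "j < dim_col C"
    then show "mat_adjoint C $$ (i, j) = C $$ (i, j)"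
      using B arg_cong[OF B_adj, of "\<lambda>M. M $$ (Suc i, Suc j)"] by (simp add: C_def)
  qed (auto simp: C_def)
  from Suc.IH[OF C this] obtain U D where U: "U \<in> carrier_mat n n" and D: "D \<in> carrier_mat n n"
    "diagonal_mat D" and UU: "mat_adjoint U * U = 1\<^sub>m n" and UD: "mat_adjoint U * C * U = D"
    by blast
  note U' = mat_adjoint_carrier[OF U]
  let ?F = "\<lambda>M N. four_block_mat M (0\<^sub>m 1 n) (0\<^sub>m n 1) N :: complex mat"
  define E where "E = mat 1 1 (\<lambda>_. e)"
  have E: "E \<in> carrier_mat 1 1"
    by (simp add: E_def)
  have BF: "B = ?F E C"
    using B by (intro eq_matI) (auto simp: E_def C_def B_col0 B_row0)
  \<comment> \<open>Bordering \<open>U\<close> with 1 leaves the eigenvalue in the corner untouched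
    and diagonalizes the block \<open>C\<close>.\<close>
  define V where "V = ?F (1\<^sub>m 1) U"
  have adj1: "mat_adjoint (1\<^sub>m 1 :: complex mat) = 1\<^sub>m 1"
    by (intro eq_matI) auto
  have V: "V \<in> carrier_mat ?N ?N"
    using U by (auto simp: V_def intro!: carrier_matI)
  note V' = mat_adjoint_carrier[OF V]
  have V_adj: "mat_adjoint V = ?F (1\<^sub>m 1) (mat_adjoint U)"
    unfolding V_def using four_block_diag_adjoint[OF one_carrier_mat U, of 1] adj1 by simp
  have VV: "mat_adjoint V * V = 1\<^sub>m ?N"
    unfolding V_adj unfolding V_def
    using four_block_diag_mult[OF one_carrier_mat U' one_carrier_mat U, of 1] UU by simp
  have VB: "mat_adjoint V * B * V = ?F E D"
    unfolding V_adj unfolding BF V_def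
    using four_block_diag_mult[OF one_carrier_mat U' E C]
      four_block_diag_mult[OF E mult_carrier_mat[OF U' C] one_carrier_mat U] UD E by simp
  have "diagonal_mat (?F E D)"
    using D E by (auto simp: diagonal_mat_def)
  moreover have "?F E D \<in> carrier_mat ?N ?N"
    using D E by (auto intro!: carrier_matI)
  moreover have "W * V \<in> carrier_mat ?N ?N"
    using W V by simp
  moreover have "mat_adjoint (W * V) * (W * V) = 1\<^sub>m ?N"
  proof -
    have "mat_adjoint (W * V) * (W * V) = mat_adjoint V * ((mat_adjoint W * W) * V)"
      using W(1) V V' W'
      by (simp add: mat_adjoint_mult[of _ ?N ?N _ ?N] assoc_mult_mat[of _ ?N ?N _ ?N _ ?N])
    then show ?thesis
      using VV V by (simp add: W(2))
  qed
  moreover have "mat_adjoint (W * V) * A * (W * V) = ?F E D"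
  proof -
    have "mat_adjoint (W * V) * A * (W * V) = mat_adjoint V * B * V"
      using W(1) V V' W' A
      by (simp add: B_def mat_adjoint_mult[of _ ?N ?N _ ?N] assoc_mult_mat[of _ ?N ?N _ ?N _ ?N])
    then show ?thesis
      by (simp add: VB)
  qed
  ultimately show ?case
    by blast
qed

lemma unitary_adjoint_right:
  fixes U :: "complex mat"
  assumes "U \<in> carrier_mat n n" "mat_adjoint U * U = 1\<^sub>m n"
  shows "U * mat_adjoint U = 1\<^sub>m n"
  using mat_mult_left_right_inverse[OF mat_adjoint_carrier[OF assms(1)] assms] .

lemma unitary_conj_inverse:
  fixes U :: "complex mat"
  assumes U: "U \<in> carrier_mat n n" "mat_adjoint U * U = 1\<^sub>m n"
    and G: "G \<in> carrier_mat n n" and D: "mat_adjoint U * G * U = D"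
  shows "G = U * D * mat_adjoint U"
proof -
  note U' = mat_adjoint_carrier[OF U(1)]
  have "U * D * mat_adjoint U = (U * mat_adjoint U) * G * (U * mat_adjoint U)"
    unfolding D[symmetric] using U(1) U' G by (simp add: assoc_mult_mat[of _ n n _ n _ n])
  also have "\<dots> = G"
    using G by (simp add: unitary_adjoint_right[OF U])
  finally show ?thesis ..
qed

text \<open>Similar matrices share their characteristic polynomial, and that of \<open>D\<close>
  splits into linear factors along the diagonal. Equality of multisets keeps track of algebraic
  multiplicities.\<close>

lemma proots_char_poly_unitary_diag:
  fixes U :: "complex mat"
  assumes U: "U \<in> carrier_mat n n" "mat_adjoint U * U = 1\<^sub>m n"
    and G: "G \<in> carrier_mat n n" and D: "mat_adjoint U * G * U = D" "diagonal_mat D"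
  shows "proots (char_poly G) = image_mset (\<lambda>j. D $$ (j, j)) (mset_set {..<n})"
proof -
  note U' = mat_adjoint_carrier[OF U(1)]
  have D': "D \<in> carrier_mat n n"
    using U U' G D by auto
  have "similar_mat_wit G D U (mat_adjoint U)"
    by (rule similar_mat_witI[OF unitary_adjoint_right[OF U] U(2) unitary_conj_inverse[OF U G D(1)] G D' U(1) U'])
  then have "char_poly G = char_poly D"
    by (intro char_poly_similar) (auto simp: similar_mat_def)
  also have "\<dots> = (\<Prod>a\<leftarrow>diag_mat D. [:- a, 1:])"
    using D(2) D' by (intro char_poly_upper_triangular[OF D']) (auto simp: diagonal_mat_def)
  finally have "proots (char_poly G) = (\<Sum>a\<leftarrow>diag_mat D. {#a#})"
    using proots_prod_list[of "map (\<lambda>a. [:- a, 1:]) (diag_mat D)"] by (auto simp: o_def image_iff)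
  also have "(\<Sum>a\<leftarrow>xs. {#a#}) = mset xs" for xs :: "complex list"
    by (induction xs) auto
  also have "mset (diag_mat D) = image_mset (\<lambda>j. D $$ (j, j)) (mset_set {..<n})"
    using D' by (simp add: diag_mat_def lessThan_atLeast0)
  finally show ?thesis .
qed

section \<open>Rank\<close>

lemma (in vec_space) rank_le_dim_row:
  assumes "A \<in> carrier_mat n nc"
  shows "rank A \<le> n"
proof -
  have "set (cols A) \<subseteq> carrier_vec n"
    using assms cols_dim by blast
  then have "subspace class_ring (span (set (cols A))) V"
    by (rule span_is_subspace)
  then have "vectorspace.dim class_ring (span_vs (set (cols A))) \<le> dim"
    by (rule subspace_dim[OF _ fin_dim fin_dim_span_cols[OF assms]])
  then show ?thesis
    by (simp add: rank_def dim_is_n)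
qed

text \<open>Every value of \<open>A * B\<close> is a value of \<open>A\<close>, so the column spaces
  are nested.\<close>

lemma (in vec_space) rank_mult_le:
  assumes A: "A \<in> carrier_mat n nc" and B: "B \<in> carrier_mat nc k"
  shows "rank (A * B) \<le> rank A"
proof -
  have AB: "A * B \<in> carrier_mat n k"
    using A B by simp
  have sub: "subspace class_ring (span (set (cols C))) V" if "C \<in> carrier_mat n l" for C l
    using that cols_dim by (intro span_is_subspace) blast
  have "col_space (A * B) \<subseteq> col_space A"
  proof
    fix y assume "y \<in> col_space (A * B)"
    then obtain x where x: "x \<in> carrier_vec k" "(A * B) *\<^sub>v x = y"
      using AB by (auto simp: col_space_eq[OF AB])
    then have "y = A *\<^sub>v (B *\<^sub>v x)"
      using A B by simp
    moreover have "B *\<^sub>v x \<in> carrier_vec nc"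
      using B x by simp
    ultimately show "y \<in> col_space A"
      using A by (auto simp: col_space_eq[OF A] intro!: carrier_vecI)
  qed
  then have nested: "subspace class_ring (span (set (cols (A * B)))) (span_vs (set (cols A)))"
    unfolding col_space_def by (intro nested_subspaces sub[OF A] sub[OF AB])
  show ?thesis
    unfolding rank_def
    using vectorspace.subspace_dim[OF subspace_is_vs[OF sub[OF A]] nested fin_dim_span_cols[OF A]]
      fin_dim_span_cols[OF AB] by simp
qed

lemma (in vec_space) rank_eq_dim_col_if_inj:
  assumes A: "A \<in> carrier_mat n k"
    and inj: "\<And>v. v \<in> carrier_vec k \<Longrightarrow> A *\<^sub>v v = 0\<^sub>v n \<Longrightarrow> v = 0\<^sub>v k"
  shows "rank A = k"
proof -
  have dist: "distinct (cols A)"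
    unfolding distinct_conv_nth
  proof (intro allI impI notI)
    fix i j assume ij: "i < length (cols A)" "j < length (cols A)" "i \<noteq> j" "cols A ! i = cols A ! j"
    \<comment> \<open>Linear independence is stated for the set of columns, so repeated columns must
      be excluded first. Two equal columns would put this non-zero vector into the kernel.\<close>
    define v :: "'a vec" where "v = unit_vec k i - unit_vec k j"
    have "A *\<^sub>v v = A *\<^sub>v unit_vec k i - A *\<^sub>v unit_vec k j"
      unfolding v_def by (rule mult_minus_distrib_mat_vec[OF A]) auto
    also have "\<dots> = col A i - col A j"
    proof -
      have "A *\<^sub>v unit_vec k l = col A l" if "l < k" for l
        using that A by (intro eq_vecI) auto
      then show ?thesis
        using ij A by simp
    qed
    also have "\<dots> = 0\<^sub>v n"
      using ij A by auto
    finally have "v = 0\<^sub>v k"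
      by (intro inj) (auto simp: v_def)
    then have "v $ i = 0"
      using ij A by simp
    then show False
      using ij A by (simp add: v_def)
  qed
  then show ?thesis
    using lin_indpt_full_rank[OF A dist] lin_depE[OF A _ dist] inj by metis
qed

section \<open>Pairings with orthonormal families\<close>

text \<open>The standard inner product, linear in the first argument. Vectors are coordinate
  functions of which only the arguments below \<open>m\<close> count, which avoids carrier
  conditions.\<close>

definition cip :: "nat \<Rightarrow> (nat \<Rightarrow> complex) \<Rightarrow> (nat \<Rightarrow> complex) \<Rightarrow> complex" where
  "cip m u v = (\<Sum>i<m. u i * cnj (v i))"

lemma cip_commute: "cip m v u = cnj (cip m u v)"
  by (simp add: cip_def mult.commute)

lemma cip_add_left: "cip m (\<lambda>i. u i + v i) w = cip m u w + cip m v w"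
  by (simp add: cip_def algebra_simps sum.distrib)

lemma cip_diff_left: "cip m (\<lambda>i. u i - v i) w = cip m u w - cip m v w"
  by (simp add: cip_def algebra_simps sum_subtractf)

lemma cip_diff_right: "cip m w (\<lambda>i. u i - v i) = cip m w u - cip m w v"
  by (simp add: cip_def algebra_simps sum_subtractf)

lemma cip_sum_left: "cip m (\<lambda>i. \<Sum>j\<in>J. c j * x j i) w = (\<Sum>j\<in>J. c j * cip m (x j) w)"
  unfolding cip_def sum_distrib_right sum_distrib_left by (subst sum.swap) (simp add: mult_ac)

lemma cip_sum_right: "cip m w (\<lambda>i. \<Sum>j\<in>J. c j * x j i) = (\<Sum>j\<in>J. cnj (c j) * cip m w (x j))"
  unfolding cip_commute[of m w] cip_sum_left by simp

lemma cip_scale_left: "cip m (\<lambda>i. c * u i) w = c * cip m u w"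
  by (simp add: cip_def sum_distrib_left mult_ac)

lemma cip_self: "cip m u u = of_real (\<Sum>i<m. (cmod (u i))\<^sup>2)"
  by (simp add: cip_def flip: complex_norm_square)

lemma cip_self_nonneg: "Re (cip m u u) \<ge> 0"
  by (simp add: cip_self sum_nonneg)

definition orthonormal_or_0 :: "nat \<Rightarrow> nat \<Rightarrow> (nat \<Rightarrow> nat \<Rightarrow> complex) \<Rightarrow> bool" where
  "orthonormal_or_0 m k x \<longleftrightarrow> (\<forall>i<k. \<forall>j<k. i \<noteq> j \<longrightarrow> cip m (x i) (x j) = 0) \<and>
     (\<forall>i<k. cip m (x i) (x i) = 1 \<or> (\<forall>a<m. x i a = 0))"

lemma orthonormal_or_0_cip_self: "orthonormal_or_0 m k x \<Longrightarrow> i < k \<Longrightarrow> cip m (x i) (x i) = 1 \<or> cip m (x i) (x i) = 0"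
  by (auto simp: orthonormal_or_0_def cip_def)

lemma orthonormal_or_0_norm_le_1:
  assumes "orthonormal_or_0 m k x" "i < k"
  shows "Re (cip m (x i) (x i)) \<le> 1"
  using orthonormal_or_0_cip_self[OF assms] by auto

text \<open>\<open>P\<close> is the orthogonal projection of \<open>z\<close> onto the span of the
  family, and the residual \<open>z - P\<close> has non-negative squared length.\<close>

lemma Bessel_inequality:
  assumes x: "orthonormal_or_0 m k x"
  shows "(\<Sum>j<k. (cmod (cip m z (x j)))\<^sup>2) \<le> Re (cip m z z)"
proof -
  define c where "c = (\<lambda>j. cip m z (x j))"
  define P where "P = (\<lambda>i. \<Sum>j<k. c j * x j i)"
  \<comment> \<open>A zero vector \<open>x j\<close> has coefficient \<open>c j = 0\<close>, so the
    identity holds for both kinds of members.\<close>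
  have cx: "c j * cip m (x j) (x j) = c j" if "j < k" for j
  proof (cases "cip m (x j) (x j) = 1")
    case False
    then have "\<forall>a<m. x j a = 0"
      using x that by (auto simp: orthonormal_or_0_def)
    then show ?thesis
      by (simp add: c_def cip_def)
  qed simp
  have Px: "cip m P (x j) = c j" if "j < k" for j
  proof -
    have "cip m P (x j) = (\<Sum>l<k. c l * cip m (x l) (x j))"
      by (simp add: P_def cip_sum_left)
    also have "\<dots> = (\<Sum>l<k. if l = j then c j else 0)"
      using x that cx[OF that] by (intro sum.cong) (auto simp: orthonormal_or_0_def)
    finally show ?thesis
      using that by simp
  qed
  define S where "S = (\<Sum>j<k. (cmod (c j))\<^sup>2)"
  have zP: "cip m z P = of_real S"
    unfolding P_def cip_sum_right by (simp add: S_def c_def complex_norm_square mult.commute del: of_real_power)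
  have PP: "cip m P P = of_real S"
    by (subst (2) P_def) (simp add: cip_sum_right Px S_def complex_norm_square mult.commute del: of_real_power)
  have Pz: "cip m P z = of_real S"
    using zP cip_commute[of m P z] by simp
  have "0 \<le> Re (cip m (\<lambda>i. z i - P i) (\<lambda>i. z i - P i))"
    by (rule cip_self_nonneg)
  also have "\<dots> = Re (cip m z z) - S"
    by (simp add: cip_diff_left cip_diff_right zP PP Pz)
  finally show ?thesis
    by (simp add: S_def c_def)
qed

lemma Bessel_inequality_left:
  assumes "orthonormal_or_0 m k x"
  shows "(\<Sum>j<k. (cmod (cip m (x j) z))\<^sup>2) \<le> Re (cip m z z)"
proof -
  have "cmod (cip m (x j) z) = cmod (cip m z (x j))" for j
    by (subst cip_commute) simp
  then show ?thesis
    using Bessel_inequality[OF assms, of z] by simp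
qed

lemma orthonormal_or_0_pairing_powr_le:
  fixes s :: "nat \<Rightarrow> real"
  assumes p: "p \<ge> 1" and s: "\<And>j. j < l \<Longrightarrow> s j \<ge> 0"
    and x: "orthonormal_or_0 m l x" and y: "orthonormal_or_0 n l y" and u: "orthonormal_or_0 m k u" and v: "orthonormal_or_0 n k v"
  shows "(\<Sum>i<k. cmod (\<Sum>j<l. of_real (s j) * cip n (v i) (y j) * cip m (x j) (u i)) powr p)
           \<le> (\<Sum>j<l. s j powr p)"
proof -
  \<comment> \<open>Half the sum of squares dominates the product of the two moduli; unlike the
    product, its row and column sums are controlled directly by Bessel's inequality.\<close>
  define w where "w = (\<lambda>i j. ((cmod (cip m (x j) (u i)))\<^sup>2 + (cmod (cip n (v i) (y j)))\<^sup>2) / 2)"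
  have "(\<Sum>i<k. cmod (\<Sum>j<l. of_real (s j) * cip n (v i) (y j) * cip m (x j) (u i)) powr p)
    \<le> (\<Sum>i<k. (\<Sum>j<l. w i j * s j) powr p)"
  proof (intro sum_mono powr_mono2)
    fix i
    have "cmod (\<Sum>j<l. of_real (s j) * cip n (v i) (y j) * cip m (x j) (u i))
      \<le> (\<Sum>j<l. cmod (of_real (s j) * cip n (v i) (y j) * cip m (x j) (u i)))"
      by (rule norm_sum)
    also have "\<dots> \<le> (\<Sum>j<l. w i j * s j)"
    proof (rule sum_mono)
      fix j assume j: "j \<in> {..<l}"
      have "cmod (cip n (v i) (y j)) * cmod (cip m (x j) (u i)) \<le> w i j"
        using sum_squares_bound[of "cmod (cip n (v i) (y j))" "cmod (cip m (x j) (u i))"]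
        by (simp add: w_def)
      then have "cmod (cip n (v i) (y j)) * cmod (cip m (x j) (u i)) * s j \<le> w i j * s j"
        using s j by (intro mult_right_mono) auto
      then show "cmod (of_real (s j) * cip n (v i) (y j) * cip m (x j) (u i)) \<le> w i j * s j"
        using s[of j] j by (simp add: norm_mult mult_ac)
    qed
    finally show "cmod (\<Sum>j<l. of_real (s j) * cip n (v i) (y j) * cip m (x j) (u i))
      \<le> (\<Sum>j<l. w i j * s j)" .
  qed (use p in auto)
  also have "\<dots> \<le> (\<Sum>j<l. s j powr p)"
  proof (rule powr_sum_substochastic)
    fix i assume i: "i \<in> {..<k}"
    \<comment> \<open>Row sums: Bessel's inequality for the families \<open>x\<close> and
      \<open>y\<close>, tested on \<open>u i\<close> and \<open>v i\<close>.\<close>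
    have "(\<Sum>j<l. w i j) = ((\<Sum>j<l. (cmod (cip m (x j) (u i)))\<^sup>2) + (\<Sum>j<l. (cmod (cip n (v i) (y j)))\<^sup>2)) / 2"
      by (simp add: w_def sum.distrib flip: sum_divide_distrib)
    also have "\<dots> \<le> (Re (cip m (u i) (u i)) + Re (cip n (v i) (v i))) / 2"
      using Bessel_inequality_left[OF x, of "u i"] Bessel_inequality[OF y, of "v i"] by simp
    also have "\<dots> \<le> 1"
      using orthonormal_or_0_norm_le_1[OF u, of i] orthonormal_or_0_norm_le_1[OF v, of i] i by simp
    finally show "(\<Sum>j<l. w i j) \<le> 1" .
  next
    fix j assume j: "j \<in> {..<l}"
    \<comment> \<open>Column sums: the roles are exchanged, with the families \<open>u\<close> and
      \<open>v\<close> tested on \<open>x j\<close> and \<open>y j\<close>.\<close>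
    have "(\<Sum>i<k. w i j) = ((\<Sum>i<k. (cmod (cip m (x j) (u i)))\<^sup>2) + (\<Sum>i<k. (cmod (cip n (v i) (y j)))\<^sup>2)) / 2"
      by (simp add: w_def sum.distrib flip: sum_divide_distrib)
    also have "\<dots> \<le> (Re (cip m (x j) (x j)) + Re (cip n (y j) (y j))) / 2"
      using Bessel_inequality[OF u, of "x j"] Bessel_inequality_left[OF v, of "y j"] by simp
    also have "\<dots> \<le> 1"
      using orthonormal_or_0_norm_le_1[OF x, of j] orthonormal_or_0_norm_le_1[OF y, of j] j by simp
    finally show "(\<Sum>i<k. w i j) \<le> 1" .
  qed (use p s in \<open>auto simp: w_def\<close>)
  finally show ?thesis .
qed

lemma cip_cong: "(\<And>i. i < m \<Longrightarrow> u i = u' i) \<Longrightarrow> (\<And>i. i < m \<Longrightarrow> v i = v' i) \<Longrightarrow> cip m u v = cip m u' v'"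
  by (simp add: cip_def)

section \<open>Singular value decomposition and Schatten norms\<close>

definition mv :: "nat \<Rightarrow> complex mat \<Rightarrow> (nat \<Rightarrow> complex) \<Rightarrow> nat \<Rightarrow> complex" where
  "mv n A v = (\<lambda>a. \<Sum>b<n. A $$ (a, b) * v b)"

text \<open>The left singular vectors of vanishing singular values are zero vectors, and there are always
  \<open>n\<close> triples, so that no case distinction on the shape or the rank of \<open>A\<close> is needed.\<close>

definition svd :: "nat \<Rightarrow> nat \<Rightarrow> complex mat \<Rightarrow> (nat \<Rightarrow> real) \<Rightarrow>
    (nat \<Rightarrow> nat \<Rightarrow> complex) \<Rightarrow> (nat \<Rightarrow> nat \<Rightarrow> complex) \<Rightarrow> bool" where
  "svd m n A s x y \<longleftrightarrow>
     (\<forall>j<n. s j \<ge> 0) \<and> orthonormal_or_0 m n x \<and> orthonormal_or_0 n n y \<and>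
     (\<forall>j<n. cip n (y j) (y j) = 1) \<and> (\<forall>j<n. s j \<noteq> 0 \<longrightarrow> cip m (x j) (x j) = 1) \<and>
     (\<forall>a<m. \<forall>b<n. A $$ (a, b) = (\<Sum>j<n. of_real (s j) * x j a * cnj (y j b))) \<and>
     image_mset (\<lambda>z. sqrt (Re z)) (proots (char_poly (mat_adjoint A * A)))
       = image_mset s (mset_set {..<n})"

text \<open>\<open>D\<close> is the Gram matrix of the columns of \<open>A * U\<close>, so these are
  orthogonal with squared lengths \<open>D $$ (j, j)\<close>. Normalized, they are the left singular
  vectors; the columns of \<open>U\<close> are the right ones.\<close>

lemma svd_of_diagonalization:
  assumes A: "A \<in> carrier_mat m n" and U: "U \<in> carrier_mat n n" "mat_adjoint U * U = 1\<^sub>m n"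
    and D: "mat_adjoint U * (mat_adjoint A * A) * U = D" "diagonal_mat D"
  shows "svd m n A (\<lambda>j. sqrt (Re (D $$ (j, j))))
    (\<lambda>j a. (A * U) $$ (a, j) / of_real (sqrt (Re (D $$ (j, j))))) (\<lambda>j b. U $$ (b, j))"
proof -
  note U' = mat_adjoint_carrier[OF U(1)] and A' = mat_adjoint_carrier[OF A]
  note UU' = unitary_adjoint_right[OF U]
  have G: "mat_adjoint A * A \<in> carrier_mat n n"
    using A A' by simp
  have D': "D \<in> carrier_mat n n"
    using U U' G D by auto
  define W where "W = A * U"
  have W: "W \<in> carrier_mat m n"
    using A U by (simp add: W_def)
  have "mat_adjoint W * W = D"
    unfolding D(1)[symmetric] W_def mat_adjoint_mult[OF A U(1)]
      assoc_mult_mat[OF U' A' mult_carrier_mat[OF A U(1)]]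
      assoc_mult_mat[OF U' G U(1)] assoc_mult_mat[OF A' A U(1)] ..
  then have D_ip: "D $$ (i, j) = (\<Sum>a<m. W $$ (a, j) * cnj (W $$ (a, i)))"
    if "i < n" "j < n" for i j
    using that W by (auto simp: scalar_prod_def lessThan_atLeast0 mult.commute)
  define s where "s = (\<lambda>j. sqrt (Re (D $$ (j, j))))"
  \<comment> \<open>Since division by 0 gives 0, \<open>x j\<close> is the zero vector whenever
    \<open>s j = 0\<close>.\<close>
  define x where "x = (\<lambda>j a. W $$ (a, j) / of_real (s j))"
  define y where "y = (\<lambda>j b. U $$ (b, j))"
  have D_diag: "D $$ (j, j) = of_real (\<Sum>a<m. (cmod (W $$ (a, j)))\<^sup>2)" if "j < n" for j
    using D_ip[OF that that] by (simp flip: complex_norm_square)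
  have s_nonneg: "s j \<ge> 0" if "j < n" for j
    using that by (simp add: s_def D_diag sum_nonneg)
  have D_s: "D $$ (j, j) = of_real ((s j)\<^sup>2)" if "j < n" for j
    using that by (simp add: s_def D_diag sum_nonneg)
  \<comment> \<open>A vanishing \<open>s j\<close> means that the column of \<open>W\<close> has
    length 0; hence \<open>W $$ (a, j) = of_real (s j) * x j a\<close> survives the division by
    0.\<close>
  have AU_0: "W $$ (a, j) = 0" if "j < n" "a < m" "s j = 0" for a j
  proof -
    have "(\<Sum>a<m. (cmod (W $$ (a, j)))\<^sup>2) = 0"
      using that D_diag[OF that(1)] D_s[OF that(1)] by (simp del: of_real_sum)
    then have "(cmod (W $$ (a, j)))\<^sup>2 = 0"
      using that by (subst (asm) sum_nonneg_eq_0_iff) auto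
    then show ?thesis
      by simp
  qed
  have AU_x: "W $$ (a, j) = of_real (s j) * x j a" if "j < n" "a < m" for a j
    using AU_0[OF that] by (cases "s j = 0") (auto simp: x_def)
  have cip_x: "cip m (x i) (x j) = D $$ (j, i) / (of_real (s i) * of_real (s j))" if "i < n" "j < n" for i j
    using D_ip[OF that(2,1)] by (simp add: cip_def x_def sum_divide_distrib)
  have cip_y: "cip n (y i) (y j) = (if i = j then 1 else 0)" if "i < n" "j < n" for i j
  proof -
    have "cip n (y i) (y j) = (mat_adjoint U * U) $$ (j, i)"
      using that U(1) by (auto simp: cip_def y_def scalar_prod_def lessThan_atLeast0 mult.commute intro!: sum.cong)
    then show ?thesis
      using that by (simp add: U(2))
  qed
  have x_self: "cip m (x j) (x j) = 1" if "j < n" "s j \<noteq> 0" for j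
    using that by (simp add: cip_x D_s power2_eq_square)
  have "orthonormal_or_0 m n x"
    unfolding orthonormal_or_0_def
  proof (intro conjI allI impI)
    fix i j assume "i < n" "j < n" "i \<noteq> j"
    then show "cip m (x i) (x j) = 0"
      using D(2) D' by (simp add: cip_x diagonal_mat_def)
  next
    fix j assume "j < n"
    then show "cip m (x j) (x j) = 1 \<or> (\<forall>a<m. x j a = 0)"
      using x_self[of j] by (cases "s j = 0") (auto simp: x_def)
  qed
  moreover have "orthonormal_or_0 n n y"
    by (auto simp: orthonormal_or_0_def cip_y)
  moreover have "A $$ (a, b) = (\<Sum>j<n. of_real (s j) * x j a * cnj (y j b))" if "a < m" "b < n" for a b
  proof -
    have "A = W * mat_adjoint U"
      unfolding W_def assoc_mult_mat[OF A U(1) U'] UU' using A by simp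
    then have "A $$ (a, b) = (W * mat_adjoint U) $$ (a, b)"
      by simp
    also have "\<dots> = (\<Sum>j<n. W $$ (a, j) * mat_adjoint U $$ (j, b))"
      using that U(1) W by (simp add: scalar_prod_def lessThan_atLeast0)
    also have "\<dots> = (\<Sum>j<n. of_real (s j) * x j a * cnj (y j b))"
      using that U(1) by (intro sum.cong refl) (simp add: AU_x y_def)
    finally show ?thesis .
  qed
  moreover have "image_mset (\<lambda>z. sqrt (Re z)) (proots (char_poly (mat_adjoint A * A)))
       = image_mset s (mset_set {..<n})"
    unfolding proots_char_poly_unitary_diag[OF U G D] by (simp add: s_def multiset.map_comp o_def)
  ultimately have "svd m n A s x y"
    using s_nonneg x_self unfolding svd_def by (auto simp: cip_y)
  then show ?thesis
    by (simp add: s_def x_def y_def W_def)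
qed

lemma svd_exists:
  assumes A: "A \<in> carrier_mat m n"
  obtains s x y where "svd m n A s x y"
proof -
  note A' = mat_adjoint_carrier[OF A]
  have "mat_adjoint (mat_adjoint A * A) = mat_adjoint A * A"
    by (simp add: mat_adjoint_mult[OF A' A])
  then show ?thesis
    using that hermitian_unitary_diagonalization[of "mat_adjoint A * A" n] svd_of_diagonalization[OF A]
    by (metis mult_carrier_mat[OF A' A])
qed

lemma svd_nonneg: "svd m n A s x y \<Longrightarrow> j < n \<Longrightarrow> s j \<ge> 0"
  by (simp add: svd_def)

lemma mv_svd:
  assumes "svd m n A s x y" "a < m"
  shows "mv n A v a = (\<Sum>j<n. (of_real (s j) * cip n v (y j)) * x j a)"
proof -
  have "mv n A v a = (\<Sum>b<n. \<Sum>j<n. of_real (s j) * x j a * cnj (y j b) * v b)"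
    using assms by (simp add: mv_def svd_def sum_distrib_right)
  also have "\<dots> = (\<Sum>j<n. (of_real (s j) * cip n v (y j)) * x j a)"
    by (subst sum.swap) (simp add: cip_def sum_distrib_left sum_distrib_right mult_ac)
  finally show ?thesis .
qed

lemma cip_mv_svd:
  assumes "svd m n A s x y"
  shows "cip m (mv n A v) u = (\<Sum>j<n. of_real (s j) * cip n v (y j) * cip m (x j) u)"
proof -
  have "cip m (mv n A v) u = cip m (\<lambda>a. \<Sum>j<n. (of_real (s j) * cip n v (y j)) * x j a) u"
    by (intro cip_cong mv_svd[OF assms] refl)
  then show ?thesis
    by (simp only: cip_sum_left)
qed

lemma mv_svd_right:
  assumes "svd m n A s x y" "j < n" "a < m"
  shows "mv n A (y j) a = of_real (s j) * x j a"
proof -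
  have "mv n A (y j) a = (\<Sum>l<n. if l = j then of_real (s j) * x j a else 0)"
    using assms unfolding mv_svd[OF assms(1,3)]
    by (intro sum.cong) (auto simp: svd_def orthonormal_or_0_def)
  then show ?thesis
    using assms by simp
qed

text \<open>Each singular value is thus itself a pairing, linear in the matrix once the two singular
  vectors are fixed.\<close>

lemma cip_mv_svd_diag:
  assumes "svd m n A s x y" "j < n"
  shows "cip m (mv n A (y j)) (x j) = of_real (s j)"
proof -
  have "cip m (mv n A (y j)) (x j) = cip m (\<lambda>a. of_real (s j) * x j a) (x j)"
    by (intro cip_cong mv_svd_right[OF assms] refl)
  also have "\<dots> = of_real (s j) * cip m (x j) (x j)"
    by (rule cip_scale_left)
  finally show ?thesis
    using assms by (cases "s j = 0") (auto simp: svd_def)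
qed

lemma svd_pairing_powr_le:
  assumes "svd m n A s x y" "orthonormal_or_0 m k u" "orthonormal_or_0 n k v" "p \<ge> 1"
  shows "(\<Sum>i<k. cmod (cip m (mv n A (v i)) (u i)) powr p) \<le> (\<Sum>j<n. s j powr p)"
  unfolding cip_mv_svd[OF assms(1)]
  by (rule orthonormal_or_0_pairing_powr_le) (use assms in \<open>auto simp: svd_def\<close>)

text \<open>\<open>A\<close> maps the right singular vectors with \<open>s j \<noteq> 0\<close> to
  non-zero multiples of orthonormal vectors. With these right singular vectors as the columns of
  \<open>B\<close>, the product \<open>A * B\<close> has full column rank, which cannot exceed the
  rank of \<open>A\<close>.\<close>

lemma card_nonzero_svd_le_rank:
  assumes A: "A \<in> carrier_mat m n" and svd: "svd m n A s x y"
  shows "card {j. j < n \<and> s j \<noteq> 0} \<le> vec_space.rank m A"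
proof -
  interpret vec_space "TYPE(complex)" m .
  define js where "js = filter (\<lambda>j. s j \<noteq> 0) [0..<n]"
  define k where "k = length js"
  define B where "B = mat n k (\<lambda>(b, i). y (js ! i) b)"
  have B: "B \<in> carrier_mat n k"
    by (simp add: B_def)
  have js: "js ! i < n" "s (js ! i) \<noteq> 0" if "i < k" for i
    using nth_mem[of i js] that by (auto simp: k_def js_def)
  have dist: "distinct js"
    by (simp add: js_def)
  define P where "P = A * B"
  have P: "P \<in> carrier_mat m k"
    using A B by (simp add: P_def)
  have AB: "P $$ (a, i) = of_real (s (js ! i)) * x (js ! i) a" if "a < m" "i < k" for a i
    using that A B js[OF that(2)] mv_svd_right[OF svd js(1)[OF that(2)] that(1)]
    by (simp add: P_def B_def mv_def scalar_prod_def lessThan_atLeast0)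
  have "rank P = k"
  proof (rule rank_eq_dim_col_if_inj)
    show "P \<in> carrier_mat m k"
      by (rule P)
    fix v assume v: "v \<in> carrier_vec k" "P *\<^sub>v v = 0\<^sub>v m"
    show "v = 0\<^sub>v k"
    proof (rule eq_vecI)
      fix i assume "i < dim_vec (0\<^sub>v k :: complex vec)"
      then have i: "i < k" by simp
      define w where "w = (\<lambda>a. \<Sum>l<k. (v $ l * of_real (s (js ! l))) * x (js ! l) a)"
      have "w a = 0" if "a < m" for a
      proof -
        have "w a = (P *\<^sub>v v) $ a"
          using that v(1) P AB[OF that]
          by (simp add: w_def scalar_prod_def lessThan_atLeast0 mult_ac)
        then show ?thesis
          using that v(2) by simp
      qed
      \<comment> \<open>Pairing the vanishing combination with one left singular vector isolates its
        coefficient.\<close>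
      then have "0 = cip m w (x (js ! i))"
        by (simp add: cip_def)
      also have "\<dots> = (\<Sum>l<k. (v $ l * of_real (s (js ! l))) * cip m (x (js ! l)) (x (js ! i)))"
        unfolding w_def by (rule cip_sum_left)
      also have "\<dots> = (\<Sum>l<k. if l = i then v $ i * of_real (s (js ! i)) else 0)"
      proof (intro sum.cong refl)
        fix l assume "l \<in> {..<k}"
        then have l: "l < k" by simp
        have "js ! l \<noteq> js ! i" if "l \<noteq> i"
          using dist l i that by (simp add: k_def nth_eq_iff_index_eq)
        then show "v $ l * of_real (s (js ! l)) * cip m (x (js ! l)) (x (js ! i))
          = (if l = i then v $ i * of_real (s (js ! i)) else 0)"
          using js[OF l] js[OF i] svd by (auto simp: svd_def orthonormal_or_0_def)
      qed
      finally have "v $ i * of_real (s (js ! i)) = 0"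
        using i by simp
      then show "v $ i = 0\<^sub>v k $ i"
        using js[OF i] i by simp
    qed (use v in simp)
  qed
  moreover have "k = card {j. j < n \<and> s j \<noteq> 0}"
    using distinct_card[OF dist] by (simp add: k_def js_def conj_commute)
  ultimately show ?thesis
    using rank_mult_le[OF A B] by (simp add: P_def)
qed

text \<open>The number of non-zero \<open>s j\<close> is at most the rank, hence at most
  \<open>min m n\<close>, so the truncation in \<open>singular_values\<close> drops only zeros and
  the sum may run over all \<open>n\<close> indices.\<close>

lemma schatten_norm_svd:
  assumes A: "A \<in> carrier_mat m n" and svd: "svd m n A s x y"
  shows "schatten_norm (ereal p) A = (\<Sum>j<n. s j powr p) powr (1 / p)"
proof -
  interpret vec_space "TYPE(complex)" m .
  define M where "M = image_mset s (mset_set {..<n})"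
  have sv: "singular_values A = take (min m n) (rev (sorted_list_of_multiset M))"
    using svd A by (simp add: singular_values_def M_def svd_def)
  have "{#x \<in># M. x \<noteq> 0#} = image_mset s (mset_set {j. j < n \<and> s j \<noteq> 0})"
    by (simp add: M_def filter_mset_image_mset)
  then have "size {#x \<in># M. x \<noteq> 0#} \<le> min m n"
    using card_nonzero_svd_le_rank[OF A svd] rank_le_dim_row[OF A] rank_le_nc[OF A] by simp
  then have "(\<Sum>t\<leftarrow>singular_values A. t powr p) = (\<Sum>t\<in>#M. t powr p)"
    unfolding sv using svd by (intro sum_list_take_descending) (auto simp: M_def svd_def)
  also have "\<dots> = (\<Sum>j<n. s j powr p)"
    by (simp add: M_def multiset.map_comp o_def sum_unfold_sum_mset)
  finally show ?thesis
    by (simp add: schatten_norm_def)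
qed

section \<open>Norm properties of the Schatten norm\<close>

lemma mv_add:
  assumes "A \<in> carrier_mat m n" "B \<in> carrier_mat m n" "a < m"
  shows "mv n (A + B) v a = mv n A v a + mv n B v a"
  using assms by (simp add: mv_def distrib_right sum.distrib)

lemma schatten_norm_triangle:
  assumes A: "A \<in> carrier_mat m n" and B: "B \<in> carrier_mat m n" and p: "p \<ge> 1"
  shows "schatten_norm (ereal p) (A + B) \<le> schatten_norm (ereal p) A + schatten_norm (ereal p) B"
proof -
  have AB: "A + B \<in> carrier_mat m n"
    using A B by simp
  obtain s x y where svd: "svd m n (A + B) s x y"
    using svd_exists[OF AB] .
  obtain sA xA yA where svdA: "svd m n A sA xA yA"
    using svd_exists[OF A] .
  obtain sB xB yB where svdB: "svd m n B sB xB yB"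
    using svd_exists[OF B] .
  have xy: "orthonormal_or_0 m n x" "orthonormal_or_0 n n y"
    using svd by (auto simp: svd_def)
  let ?a = "\<lambda>j. cmod (cip m (mv n A (y j)) (x j))" and ?b = "\<lambda>j. cmod (cip m (mv n B (y j)) (x j))"
  \<comment> \<open>The singular vectors of the sum stay fixed while the pairing is split between
    \<open>A\<close> and \<open>B\<close>.\<close>
  have s_le: "s j \<le> ?a j + ?b j" if "j < n" for j
  proof -
    have "cip m (mv n (A + B) (y j)) (x j) = cip m (\<lambda>a. mv n A (y j) a + mv n B (y j) a) (x j)"
      by (intro cip_cong mv_add[OF A B] refl)
    then have "of_real (s j) = cip m (mv n A (y j)) (x j) + cip m (mv n B (y j)) (x j)"
      by (simp only: cip_mv_svd_diag[OF svd that] cip_add_left)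
    then have "cmod (of_real (s j)) \<le> ?a j + ?b j"
      by (simp only: norm_triangle_ineq)
    then show ?thesis
      by simp
  qed
  have "(\<Sum>j<n. s j powr p) powr (1 / p) \<le> (\<Sum>j<n. (?a j + ?b j) powr p) powr (1 / p)"
    using p svd_nonneg[OF svd] s_le
    by (intro powr_mono2 sum_mono) (auto intro: sum_nonneg)
  also have "\<dots> \<le> (\<Sum>j<n. ?a j powr p) powr (1 / p) + (\<Sum>j<n. ?b j powr p) powr (1 / p)"
    using p by (intro Minkowski_sum_powr) auto
  also have "\<dots> \<le> (\<Sum>j<n. sA j powr p) powr (1 / p) + (\<Sum>j<n. sB j powr p) powr (1 / p)"
    using p svd_pairing_powr_le[OF svdA xy p] svd_pairing_powr_le[OF svdB xy p]
    by (intro add_mono powr_mono2) (auto intro: sum_nonneg)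
  finally show ?thesis
    by (simp add: schatten_norm_svd[OF AB svd] schatten_norm_svd[OF A svdA] schatten_norm_svd[OF B svdB])
qed

lemma schatten_norm_uminus:
  assumes "A \<in> carrier_mat m n"
  shows "schatten_norm p (- A) = schatten_norm p A"
proof -
  have "mat_adjoint (- A) * (- A) = mat_adjoint A * A"
    using assms by (intro eq_matI) (auto simp: scalar_prod_def sum_negf)
  then show ?thesis
    by (simp add: schatten_norm_def singular_values_def)
qed

lemma schatten_norm_nonneg: "schatten_norm (ereal p) A \<ge> 0"
  by (simp add: schatten_norm_def)

section \<open>The operator norm\<close>

text \<open>The supremum is meaningful only for a set bounded above; the sum of the moduli of all
  entries is a crude bound on the unit ball.\<close>

lemma op_norm2_bound:
  assumes A: "A \<in> carrier_mat m n" and v: "v \<in> carrier_vec n" "vec_norm2 v \<le> 1"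
  shows "vec_norm2 (A *\<^sub>v v) \<le> op_norm2 A"
  unfolding op_norm2_def
proof (rule cSUP_upper)
  show "v \<in> {v \<in> carrier_vec (dim_col A). vec_norm2 v \<le> 1}"
    using A v by simp
  show "bdd_above ((\<lambda>v. vec_norm2 (A *\<^sub>v v)) ` {v \<in> carrier_vec (dim_col A). vec_norm2 v \<le> 1})"
  proof (rule bdd_aboveI2)
    fix v assume "v \<in> {v \<in> carrier_vec (dim_col A). vec_norm2 v \<le> 1}"
    then have v: "v \<in> carrier_vec n" "vec_norm2 v \<le> 1"
      using A by auto
    have v_le: "cmod (v $ b) \<le> 1" if "b < n" for b
      using member_le_L2_set[of "{..<n}" b "\<lambda>i. cmod (v $ i)"] v that by (simp add: vec_norm2_def)
    have "vec_norm2 (A *\<^sub>v v) \<le> (\<Sum>a<m. cmod ((A *\<^sub>v v) $ a))"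
      using A L2_set_le_sum[of "{..<m}" "\<lambda>a. cmod ((A *\<^sub>v v) $ a)"]
      by (simp add: vec_norm2_def)
    also have "\<dots> \<le> (\<Sum>a<m. \<Sum>b<n. cmod (A $$ (a, b)))"
    proof (rule sum_mono)
      fix a assume "a \<in> {..<m}"
      then have "cmod ((A *\<^sub>v v) $ a) = cmod (\<Sum>b<n. A $$ (a, b) * v $ b)"
        using A v by (simp add: scalar_prod_def lessThan_atLeast0)
      also have "\<dots> \<le> (\<Sum>b<n. cmod (A $$ (a, b)) * 1)"
        using v_le by (intro sum_norm_le) (auto simp: norm_mult intro!: mult_left_le)
      finally show "cmod ((A *\<^sub>v v) $ a) \<le> (\<Sum>b<n. cmod (A $$ (a, b)))"
        by simp
    qed
    finally show "vec_norm2 (A *\<^sub>v v) \<le> (\<Sum>a<m. \<Sum>b<n. cmod (A $$ (a, b)))" .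
  qed
qed

lemma op_norm2_least:
  assumes A: "A \<in> carrier_mat m n"
    and "\<And>v. v \<in> carrier_vec n \<Longrightarrow> vec_norm2 v \<le> 1 \<Longrightarrow> vec_norm2 (A *\<^sub>v v) \<le> c"
  shows "op_norm2 A \<le> c"
  unfolding op_norm2_def
proof (rule cSUP_least)
  have "0\<^sub>v (dim_col A) \<in> {v \<in> carrier_vec (dim_col A). vec_norm2 v \<le> 1}"
    by (simp add: vec_norm2_def L2_set_def)
  then show "{v \<in> carrier_vec (dim_col A). vec_norm2 v \<le> 1} \<noteq> {}"
    by blast
qed (use assms in auto)

lemma op_norm2_nonneg:
  assumes "A \<in> carrier_mat m n"
  shows "op_norm2 A \<ge> 0"
proof -
  have "0 \<le> vec_norm2 (A *\<^sub>v 0\<^sub>v n)"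
    by (simp add: vec_norm2_def L2_set_nonneg)
  also have "\<dots> \<le> op_norm2 A"
    using assms by (intro op_norm2_bound) (auto simp: vec_norm2_def L2_set_def)
  finally show ?thesis .
qed

lemma op_norm2_triangle:
  assumes A: "A \<in> carrier_mat m n" and B: "B \<in> carrier_mat m n"
  shows "op_norm2 (A + B) \<le> op_norm2 A + op_norm2 B"
proof (rule op_norm2_least[of _ m n])
  fix v :: "complex vec" assume v: "v \<in> carrier_vec n" "vec_norm2 v \<le> 1"
  have "vec_norm2 ((A + B) *\<^sub>v v) = L2_set (\<lambda>i. cmod ((A *\<^sub>v v) $ i + (B *\<^sub>v v) $ i)) {..<m}"
    using A B v by (auto simp: vec_norm2_def add_mult_distrib_mat_vec[OF A B] intro!: L2_set_cong)
  also have "\<dots> \<le> L2_set (\<lambda>i. cmod ((A *\<^sub>v v) $ i) + cmod ((B *\<^sub>v v) $ i)) {..<m}"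
    by (intro L2_set_mono norm_triangle_ineq) auto
  also have "\<dots> \<le> vec_norm2 (A *\<^sub>v v) + vec_norm2 (B *\<^sub>v v)"
    using A B L2_set_triangle_ineq[of "\<lambda>i. cmod ((A *\<^sub>v v) $ i)" "\<lambda>i. cmod ((B *\<^sub>v v) $ i)" "{..<m}"]
    by (simp add: vec_norm2_def)
  also have "\<dots> \<le> op_norm2 A + op_norm2 B"
    by (intro add_mono op_norm2_bound[OF A] op_norm2_bound[OF B] v)
  finally show "vec_norm2 ((A + B) *\<^sub>v v) \<le> op_norm2 A + op_norm2 B" .
qed (use A B in simp)

lemma op_norm2_uminus:
  assumes A: "A \<in> carrier_mat m n"
  shows "op_norm2 (- A) \<le> op_norm2 A"
proof (rule op_norm2_least[of _ m n])
  fix v :: "complex vec" assume v: "v \<in> carrier_vec n" "vec_norm2 v \<le> 1"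
  have "vec_norm2 (- A *\<^sub>v v) = vec_norm2 (A *\<^sub>v v)"
    using A v by (auto simp: vec_norm2_def intro!: L2_set_cong)
  then show "vec_norm2 (- A *\<^sub>v v) \<le> op_norm2 A"
    using op_norm2_bound[OF A v] by simp
qed (use A in simp)

text \<open>A unit vector selects a column containing a non-zero entry, whose modulus bounds the
  norm from below.\<close>

lemma op_norm2_pos:
  assumes A: "A \<in> carrier_mat m n" "A \<noteq> 0\<^sub>m m n"
  shows "op_norm2 A > 0"
proof -
  obtain a b where ab: "a < m" "b < n" "A $$ (a, b) \<noteq> 0"
    using A by (metis carrier_matD eq_matI index_zero_mat)
  have "vec_norm2 (unit_vec n b) = L2_set (\<lambda>i. if i = b then 1 else 0) {..<n}"
    using ab by (auto simp: vec_norm2_def intro!: L2_set_cong)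
  also have "\<dots> = 1"
    using ab by (simp add: L2_set_def if_distrib[of "\<lambda>u. u\<^sup>2"] cong: if_cong)
  finally have "vec_norm2 (A *\<^sub>v unit_vec n b) \<le> op_norm2 A"
    by (intro op_norm2_bound[OF A(1)]) auto
  moreover have "cmod (A $$ (a, b)) \<le> vec_norm2 (A *\<^sub>v unit_vec n b)"
    using member_le_L2_set[of "{..<m}" a "\<lambda>i. cmod ((A *\<^sub>v unit_vec n b) $ i)"] A ab
    by (simp add: vec_norm2_def)
  ultimately show ?thesis
    using ab by (smt (verit) zero_less_norm_iff)
qed

section \<open>Operator norm and singular values\<close>

lemma vec_norm2_vec: "vec_norm2 (vec n f) = sqrt (Re (cip n f f))"
  by (simp add: vec_norm2_def L2_set_def cip_self)

lemma mult_mat_vec_mv: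
  assumes "A \<in> carrier_mat m n"
  shows "A *\<^sub>v vec n f = vec m (mv n A f)"
  using assms by (intro eq_vecI) (auto simp: mv_def scalar_prod_def lessThan_atLeast0)

lemma pairing_le_op_norm2:
  assumes A: "A \<in> carrier_mat m n" and u: "orthonormal_or_0 m k u" and v: "orthonormal_or_0 n k v" and j: "j < k"
  shows "cmod (cip m (mv n A (v j)) (u j)) \<le> op_norm2 A"
proof -
  let ?w = "mv n A (v j)"
  \<comment> \<open>Cauchy-Schwarz by way of Bessel's inequality, which also covers a zero vector
    \<open>u j\<close>.\<close>
  have "(cmod (cip m ?w (u j)))\<^sup>2 \<le> (\<Sum>i<k. (cmod (cip m ?w (u i)))\<^sup>2)"
    using j by (intro member_le_sum) auto
  also have "\<dots> \<le> Re (cip m ?w ?w)"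
    by (rule Bessel_inequality[OF u])
  finally have "cmod (cip m ?w (u j)) \<le> sqrt (Re (cip m ?w ?w))"
    by (rule real_le_rsqrt)
  also have "\<dots> = vec_norm2 (A *\<^sub>v vec n (v j))"
    by (simp add: mult_mat_vec_mv[OF A] vec_norm2_vec)
  also have "\<dots> \<le> op_norm2 A"
    using orthonormal_or_0_norm_le_1[OF v j] by (intro op_norm2_bound[OF A]) (auto simp: vec_norm2_vec)
  finally show ?thesis .
qed

lemma singular_value_le_op_norm2:
  assumes A: "A \<in> carrier_mat m n" and svd: "svd m n A s x y" and j: "j < n"
  shows "s j \<le> op_norm2 A"
proof -
  have "orthonormal_or_0 m n x" "orthonormal_or_0 n n y"
    using svd by (auto simp: svd_def)
  from pairing_le_op_norm2[OF A this j] show ?thesis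
    by (simp add: cip_mv_svd_diag[OF svd j])
qed

text \<open>The squared length of the image of \<open>f\<close> is the sum of
  \<open>(s j)\<^sup>2 * (cmod (cip n f (y j)))\<^sup>2\<close>, which Bessel's inequality bounds.
  Together with \<open>singular_value_le_op_norm2\<close> this ties the supremum to the largest
  singular value.\<close>

lemma op_norm2_le_singular_bound:
  assumes A: "A \<in> carrier_mat m n" and svd: "svd m n A s x y"
    and c: "c \<ge> 0" "\<And>j. j < n \<Longrightarrow> s j \<le> c"
  shows "op_norm2 A \<le> c"
proof (rule op_norm2_least[OF A])
  fix v :: "complex vec" assume v: "v \<in> carrier_vec n" "vec_norm2 v \<le> 1"
  define f where "f = (\<lambda>i. v $ i)"
  have vf: "v = vec n f"
    using v(1) by (auto simp: f_def)
  let ?P = "mv n A f"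
  have y: "orthonormal_or_0 n n y"
    using svd by (simp add: svd_def)
  \<comment> \<open>The factor \<open>s j\<close> on both sides makes the case
    \<open>s j = 0\<close> trivial, where \<open>x j\<close> need not be a unit vector.\<close>
  have Px: "of_real (s j) * cip m ?P (x j) = of_real (s j) * (of_real (s j) * cip n f (y j))" if j: "j < n" for j
  proof (cases "s j = 0")
    case False
    have "cip m ?P (x j) = (\<Sum>l<n. if l = j then of_real (s j) * cip n f (y j) else 0)"
      unfolding cip_mv_svd[OF svd] using svd j False
      by (intro sum.cong) (auto simp: svd_def orthonormal_or_0_def)
    then show ?thesis
      using j by simp
  qed simp
  have "cip m ?P ?P = (\<Sum>j<n. cip n f (y j) * cnj (of_real (s j) * cip m ?P (x j)))"
    by (subst cip_mv_svd[OF svd]) (simp add: cip_commute[of m "x _" ?P] mult_ac)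
  also have "\<dots> = of_real (\<Sum>j<n. (s j)\<^sup>2 * (cmod (cip n f (y j)))\<^sup>2)"
    by (simp add: Px complex_norm_square power2_eq_square mult_ac del: complex_cnj_mult)
      (simp add: complex_norm_square[symmetric] power2_eq_square mult_ac)
  finally have "Re (cip m ?P ?P) = (\<Sum>j<n. (s j)\<^sup>2 * (cmod (cip n f (y j)))\<^sup>2)"
    by simp
  also have "\<dots> \<le> (\<Sum>j<n. c\<^sup>2 * (cmod (cip n f (y j)))\<^sup>2)"
    using c svd_nonneg[OF svd] by (intro sum_mono mult_right_mono power_mono) auto
  also have "\<dots> \<le> c\<^sup>2 * Re (cip n f f)"
    unfolding sum_distrib_left[symmetric] by (intro mult_left_mono Bessel_inequality[OF y]) simp
  also have "\<dots> \<le> c\<^sup>2 * 1"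
    using v(2) by (intro mult_left_mono) (auto simp: vf vec_norm2_vec)
  finally show "vec_norm2 (A *\<^sub>v v) \<le> c"
    unfolding vf mult_mat_vec_mv[OF A] vec_norm2_vec using c by (intro real_le_lsqrt) (auto simp: cip_self_nonneg)
qed

section \<open>Bounds by rank and positive semi-definite perturbations\<close>

text \<open>Only the non-zero singular values contribute; there are at most as many as the rank, and
  each is at most the operator norm.\<close>

lemma schatten_norm_le_rank:
  assumes A: "A \<in> carrier_mat m n" and p: "p \<ge> 1"
  shows "schatten_norm (ereal p) A \<le> real (vec_space.rank m A) powr (1 / p) * op_norm2 A"
proof -
  obtain s x y where svd: "svd m n A s x y"
    using svd_exists[OF A] .
  have "(\<Sum>j<n. s j powr p) = (\<Sum>j\<in>{j. j < n \<and> s j \<noteq> 0}. s j powr p)"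
    by (intro sum.mono_neutral_right) auto
  also have "\<dots> \<le> (\<Sum>j\<in>{j. j < n \<and> s j \<noteq> 0}. op_norm2 A powr p)"
    using p svd_nonneg[OF svd] singular_value_le_op_norm2[OF A svd]
    by (intro sum_mono powr_mono2) auto
  also have "\<dots> \<le> real (vec_space.rank m A) * op_norm2 A powr p"
    using card_nonzero_svd_le_rank[OF A svd] by (simp add: mult_right_mono)
  finally have "schatten_norm (ereal p) A \<le> (real (vec_space.rank m A) * op_norm2 A powr p) powr (1 / p)"
    unfolding schatten_norm_svd[OF A svd] using p by (intro powr_mono2) (auto intro: sum_nonneg)
  also have "\<dots> = real (vec_space.rank m A) powr (1 / p) * op_norm2 A"
    using p op_norm2_nonneg[OF A] by (simp add: powr_mult powr_powr)
  finally show ?thesis .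
qed

section \<open>Quadratic forms of positive semi-definite matrices\<close>

lemma hermitian_psd_cip_mv:
  assumes "hermitian_psd A" "A \<in> carrier_mat n n"
  shows "0 \<le> cip n (mv n A f) f"
proof -
  have "0 \<le> (A *\<^sub>v vec n f) \<bullet>c vec n f"
    using assms unfolding hermitian_psd_def by (metis carrier_matD(1) vec_carrier)
  also have "\<dots> = cip n (mv n A f) f"
    by (simp add: mult_mat_vec_mv[OF assms(2)] scalar_prod_def cip_def lessThan_atLeast0)
  finally show ?thesis .
qed

text \<open>Here \<open>mat_adjoint A * A\<close> is the square of \<open>A\<close>, so a unitary
  matrix diagonalizing \<open>A\<close> to \<open>D\<close> diagonalizes it to \<open>D * D\<close>.
  As the entries of \<open>D\<close> are non-negative, the singular values are the eigenvalues, and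
  the eigenvectors serve as right singular vectors.\<close>

lemma hermitian_psd_svd:
  assumes psd: "hermitian_psd A" and A: "A \<in> carrier_mat n n"
  obtains s x y where "svd n n A s x y" "\<And>j. j < n \<Longrightarrow> cip n (mv n A (y j)) (y j) = of_real (s j)"
proof -
  have A_adj: "mat_adjoint A = A"
    using psd by (simp add: hermitian_psd_def)
  obtain U D where U: "U \<in> carrier_mat n n" "mat_adjoint U * U = 1\<^sub>m n"
    and D: "D \<in> carrier_mat n n" "diagonal_mat D" "mat_adjoint U * A * U = D"
    using hermitian_unitary_diagonalization[OF A A_adj] by blast
  note U' = mat_adjoint_carrier[OF U(1)]
  define y where "y = (\<lambda>j b. U $$ (b, j))"
  have D_cip: "D $$ (j, j) = cip n (mv n A (y j)) (y j)" if "j < n" for j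
  proof -
    have "D = mat_adjoint U * (A * U)"
      using D(3) assoc_mult_mat[OF U' A U(1)] by simp
    then show ?thesis
      using that U(1) A
      by (simp add: cip_def mv_def y_def scalar_prod_def lessThan_atLeast0 mult.commute)
  qed
  have D_real: "D $$ (j, j) = of_real (Re (D $$ (j, j)))" "Re (D $$ (j, j)) \<ge> 0" if "j < n" for j
    using hermitian_psd_cip_mv[OF psd A, of "y j"] that
    by (auto simp: D_cip less_eq_complex_def complex_eq_iff)
  have "mat_adjoint U * (mat_adjoint A * A) * U = D * D"
  proof -
    have "D * D = (mat_adjoint U * A) * (U * (mat_adjoint U * (A * U)))"
      using U(1) U' A by (simp add: assoc_mult_mat[of _ n n _ n _ n] flip: D(3))
    also have "U * (mat_adjoint U * (A * U)) = (U * mat_adjoint U) * (A * U)"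
      using U(1) U' A by (simp add: assoc_mult_mat[of _ n n _ n _ n])
    also have "\<dots> = A * U"
      using U(1) A by (simp add: unitary_adjoint_right[OF U])
    finally show ?thesis
      using U(1) U' A by (simp add: A_adj assoc_mult_mat[of _ n n _ n _ n])
  qed
  moreover have DD: "(D * D) $$ (i, j) = (if i = j then (D $$ (j, j))\<^sup>2 else 0)" if "i < n" "j < n" for i j
  proof -
    have "(D * D) $$ (i, j) = (\<Sum>k<n. D $$ (i, k) * D $$ (k, j))"
      using that D(1) by (simp add: scalar_prod_def lessThan_atLeast0)
    also have "\<dots> = (\<Sum>k<n. if k = j then (if i = j then (D $$ (j, j))\<^sup>2 else 0) else 0)"
      using that D(1,2) by (intro sum.cong) (auto simp: diagonal_mat_def power2_eq_square)
    finally show ?thesis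
      using that by simp
  qed
  moreover have "diagonal_mat (D * D)"
    using D(1) by (auto simp: diagonal_mat_def DD simp del: index_mult_mat(1))
  ultimately have svd: "svd n n A (\<lambda>j. sqrt (Re ((D * D) $$ (j, j))))
    (\<lambda>j a. (A * U) $$ (a, j) / of_real (sqrt (Re ((D * D) $$ (j, j))))) y"
    unfolding y_def by (intro svd_of_diagonalization[OF A U])
  have "sqrt (Re ((D * D) $$ (j, j))) = Re (D $$ (j, j))" if "j < n" for j
  proof -
    have "Re ((D $$ (j, j))\<^sup>2) = (Re (D $$ (j, j)))\<^sup>2"
      by (subst D_real(1)[OF that]) (simp flip: of_real_power)
    then show ?thesis
      using D_real(2)[OF that] by (simp add: DD[OF that that] del: index_mult_mat(1))
  qed
  then show ?thesis
    using that[OF svd] D_cip D_real(1) by simp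
qed

text \<open>The quadratic form of \<open>E\<close> is non-negative, so adding \<open>E\<close> can
  only increase the real part of the pairing.\<close>

lemma psd_singular_value_le_pairing:
  assumes A: "A \<in> carrier_mat n n" and E: "E \<in> carrier_mat n n" "hermitian_psd E"
    and s: "cip n (mv n A f) f = of_real s"
  shows "s \<le> cmod (cip n (mv n (A + E) f) f)"
proof -
  have "s \<le> Re (cip n (mv n A f) f + cip n (mv n E f) f)"
    using hermitian_psd_cip_mv[OF E(2,1), of f] s by (simp add: less_eq_complex_def)
  also have "cip n (mv n A f) f + cip n (mv n E f) f = cip n (mv n (A + E) f) f"
    unfolding cip_add_left[symmetric] by (intro cip_cong mv_add[OF A E(1), symmetric] refl)
  also have "Re \<dots> \<le> cmod \<dots>"
    by (rule complex_Re_le_cmod)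
  finally show ?thesis .
qed

text \<open>Every singular value of \<open>A\<close> is bounded by a pairing of \<open>A + E\<close>
  with an eigenvector of \<open>A\<close>, hence by the operator norm of
  \<open>A + E\<close>.\<close>

lemma op_norm2_psd_mono:
  assumes A: "A \<in> carrier_mat n n" "hermitian_psd A" and E: "E \<in> carrier_mat n n" "hermitian_psd E"
  shows "op_norm2 A \<le> op_norm2 (A + E)"
proof -
  have AE: "A + E \<in> carrier_mat n n"
    using A E by simp
  obtain s x y where svd: "svd n n A s x y"
    and s: "\<And>j. j < n \<Longrightarrow> cip n (mv n A (y j)) (y j) = of_real (s j)"
    using hermitian_psd_svd[OF A(2,1)] by metis
  have y: "orthonormal_or_0 n n y"
    using svd by (simp add: svd_def)
  show ?thesis
  proof (rule op_norm2_le_singular_bound[OF A(1) svd op_norm2_nonneg[OF AE]])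
    fix j assume j: "j < n"
    have "s j \<le> cmod (cip n (mv n (A + E) (y j)) (y j))"
      by (rule psd_singular_value_le_pairing[OF A(1) E s[OF j]])
    also have "\<dots> \<le> op_norm2 (A + E)"
      by (rule pairing_le_op_norm2[OF AE y y j])
    finally show "s j \<le> op_norm2 (A + E)" .
  qed
qed

lemma schatten_norm_psd_mono:
  assumes A: "A \<in> carrier_mat n n" "hermitian_psd A" and E: "E \<in> carrier_mat n n" "hermitian_psd E"
    and p: "p \<ge> 1"
  shows "schatten_norm (ereal p) A \<le> schatten_norm (ereal p) (A + E)"
proof -
  have AE: "A + E \<in> carrier_mat n n"
    using A E by simp
  obtain s x y where svd: "svd n n A s x y"
    and s: "\<And>j. j < n \<Longrightarrow> cip n (mv n A (y j)) (y j) = of_real (s j)"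
    using hermitian_psd_svd[OF A(2,1)] by metis
  obtain s' x' y' where svd': "svd n n (A + E) s' x' y'"
    using svd_exists[OF AE] .
  have y: "orthonormal_or_0 n n y"
    using svd by (simp add: svd_def)
  have "(\<Sum>j<n. s j powr p) \<le> (\<Sum>j<n. cmod (cip n (mv n (A + E) (y j)) (y j)) powr p)"
    using p svd_nonneg[OF svd] psd_singular_value_le_pairing[OF A(1) E s]
    by (intro sum_mono powr_mono2) auto
  also have "\<dots> \<le> (\<Sum>j<n. s' j powr p)"
    by (rule svd_pairing_powr_le[OF svd' y y p])
  finally show ?thesis
    unfolding schatten_norm_svd[OF A(1) svd] schatten_norm_svd[OF AE svd']
    using p by (intro powr_mono2) (auto intro: sum_nonneg)
qed

section \<open>Stable rank bounds\<close>

lemma proot_stable_rank: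
  assumes A: "A \<in> carrier_mat m n" "A \<noteq> 0\<^sub>m m n" and p: "p \<ge> 1"
  shows "proot (ereal p) (stable_rank (ereal p) A) = schatten_norm (ereal p) A / op_norm2 A"
  using assms op_norm2_pos[OF A] schatten_norm_nonneg[of p A]
  by (simp add: proot_def stable_rank_def powr_divide powr_powr)

theorem theorem5p18:
  fixes p :: ereal and m n r :: nat and A E :: "complex mat" and \<epsilon> :: real
  assumes "1 \<le> p"
    and "A \<in> carrier_mat m n" and "E \<in> carrier_mat m n"
    and "A \<noteq> 0\<^sub>m m n"
    and "r = vec_space.rank m E"
    and "\<epsilon> = op_norm2 E / op_norm2 A" and "\<epsilon> < 1"
  shows "1 / (1 + \<epsilon>) * (proot p (stable_rank p A) - proot p (real r) * \<epsilon>)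
           \<le> proot p (stable_rank p (A + E)) \<and>
         proot p (stable_rank p (A + E))
           \<le> 1 / (1 - \<epsilon>) * (proot p (stable_rank p A) + proot p (real r) * \<epsilon>) \<and>
         (m = n \<and> hermitian_psd A \<and> hermitian_psd E \<longrightarrow>
           proot p (stable_rank p A) / (1 + \<epsilon>) \<le> proot p (stable_rank p (A + E)) \<and>
           proot p (stable_rank p (A + E)) \<le> proot p (stable_rank p A) + proot p (real r) * \<epsilon>)"
proof -
  note A = assms(2) and E = assms(3)
  have AE: "A + E \<in> carrier_mat m n"
    using A E by simp
  define N where "N = op_norm2 A"
  have N: "N > 0"
    using op_norm2_pos[OF A assms(4)] by (simp add: N_def)
  have \<epsilon>: "0 \<le> \<epsilon>" "\<epsilon> < 1"
    using N assms(6,7) op_norm2_nonneg[OF E] by (auto simp: N_def)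
  have NE: "op_norm2 E = \<epsilon> * N"
    using N assms(6) by (simp add: N_def)
  \<comment> \<open>Applied to this decomposition, the triangle inequalities give the lower bounds
    for both norms of \<open>A + E\<close>.\<close>
  have A_eq: "A = (A + E) + (- E)"
    using A E by (intro eq_matI) auto
  have upper: "op_norm2 (A + E) \<le> (1 + \<epsilon>) * N"
    using op_norm2_triangle[OF A E] by (simp add: NE distrib_right flip: N_def)
  have lower: "(1 - \<epsilon>) * N \<le> op_norm2 (A + E)"
  proof -
    have "N \<le> op_norm2 (A + E) + op_norm2 (- E)"
      unfolding N_def by (subst A_eq, rule op_norm2_triangle[OF AE]) (use E in simp)
    then show ?thesis
      using op_norm2_uminus[OF E] by (simp add: NE left_diff_distrib)
  qed
  have M: "op_norm2 (A + E) > 0"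
    using lower N \<epsilon> by (smt (verit) mult_pos_pos)
  \<comment> \<open>The bound \<open>lower\<close> and \<open>\<epsilon> < 1\<close> make the norm
    of \<open>A + E\<close> positive, which excludes the zero matrix and its special value of
    \<open>stable_rank\<close>.\<close>
  have "op_norm2 (0\<^sub>m m n) \<le> 0"
    by (rule op_norm2_least[of _ m n]) (auto simp: vec_norm2_def L2_set_def)
  with M have AE0: "A + E \<noteq> 0\<^sub>m m n"
    by auto
  show ?thesis
  proof (cases p)
    case PInf
    \<comment> \<open>Both roots are 1, and \<open>proot p (real r)\<close> is 0 or 1, so only
      elementary inequalities in \<open>\<epsilon>\<close> remain.\<close>
    have "stable_rank p A = 1" "stable_rank p (A + E) = 1"
      using carrier_matD[OF A] carrier_matD[OF E] assms(4) AE0 PInf by (auto simp: stable_rank_def)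
    then show ?thesis
      using PInf \<epsilon> by (auto simp: proot_def field_simps)
  next
    case MInf
    then show ?thesis
      using assms(1) by simp
  next
    case (real q)
    have q: "q \<ge> 1"
      using assms(1) real by simp
    define S where "S = schatten_norm (ereal q) A"
    define T where "T = schatten_norm (ereal q) (A + E)"
    define R where "R = real r powr (1 / q)"
    define M where "M = op_norm2 (A + E)"
    have nonneg: "S \<ge> 0" "T \<ge> 0" "R \<ge> 0"
      by (auto simp: S_def T_def R_def schatten_norm_nonneg)
    have SE: "schatten_norm (ereal q) E \<le> R * (\<epsilon> * N)"
      using schatten_norm_le_rank[OF E q] by (simp add: R_def NE assms(5))
    have TS: "T \<le> S + R * (\<epsilon> * N)"
      using schatten_norm_triangle[OF A E q] SE by (simp add: T_def S_def)
    have "S \<le> T + schatten_norm (ereal q) (- E)"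
      unfolding S_def T_def by (subst A_eq, rule schatten_norm_triangle[OF AE _ q]) (use E in simp)
    then have ST: "S - R * (\<epsilon> * N) \<le> T"
      using SE by (simp add: schatten_norm_uminus[OF E])
    have proots: "proot p (stable_rank p A) = S / N" "proot p (stable_rank p (A + E)) = T / M"
      "proot p (real r) = R"
      using proot_stable_rank[OF A assms(4) q] proot_stable_rank[OF AE AE0 q]
      by (auto simp: real S_def T_def N_def M_def R_def proot_def)
    have T_lower: "T / ((1 + \<epsilon>) * N) \<le> T / M"
      using upper \<open>op_norm2 (A + E) > 0\<close> nonneg by (intro divide_left_mono) (auto simp: M_def intro!: mult_pos_pos)
    have "1 / (1 + \<epsilon>) * (S / N - R * \<epsilon>) = (S - R * (\<epsilon> * N)) / ((1 + \<epsilon>) * N)"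
      using N \<epsilon> by (simp add: diff_divide_distrib right_diff_distrib)
    also have "\<dots> \<le> T / ((1 + \<epsilon>) * N)"
      using ST N \<epsilon> by (intro divide_right_mono) auto
    also note T_lower
    finally have 1: "1 / (1 + \<epsilon>) * (S / N - R * \<epsilon>) \<le> T / M" .
    have "T / M \<le> T / ((1 - \<epsilon>) * N)"
      using lower N \<epsilon> \<open>op_norm2 (A + E) > 0\<close> nonneg
      by (intro divide_left_mono) (auto simp: M_def intro!: mult_pos_pos)
    also have "\<dots> \<le> (S + R * (\<epsilon> * N)) / ((1 - \<epsilon>) * N)"
      using TS N \<epsilon> by (intro divide_right_mono) auto
    also have "\<dots> = 1 / (1 - \<epsilon>) * (S / N + R * \<epsilon>)"
      using N \<epsilon> by (simp add: add_divide_distrib distrib_left)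
    finally have 2: "T / M \<le> 1 / (1 - \<epsilon>) * (S / N + R * \<epsilon>)" .
    have 3: "S / N / (1 + \<epsilon>) \<le> T / M \<and> T / M \<le> S / N + R * \<epsilon>"
      if psd: "m = n" "hermitian_psd A" "hermitian_psd E"
    proof
      have A': "A \<in> carrier_mat n n" and E': "E \<in> carrier_mat n n"
        using A E psd(1) by auto
      have "S / N / (1 + \<epsilon>) = S / ((1 + \<epsilon>) * N)"
        by (simp add: mult.commute)
      \<comment> \<open>Monotonicity gives \<open>S \<le> T\<close> directly, so the loss
        \<open>R * \<epsilon>\<close> of the general lower bound disappears.\<close>
      also have "\<dots> \<le> T / ((1 + \<epsilon>) * N)"
        using schatten_norm_psd_mono[OF A' psd(2) E' psd(3) q] N \<epsilon>
        by (intro divide_right_mono) (auto simp: S_def T_def)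
      also note T_lower
      finally show "S / N / (1 + \<epsilon>) \<le> T / M" .
      \<comment> \<open>The operator norm does not decrease under \<open>E\<close>, so the
        denominator \<open>N\<close> replaces \<open>(1 - \<epsilon>) * N\<close>.\<close>
      have "T / M \<le> T / N"
        using op_norm2_psd_mono[OF A' psd(2) E' psd(3)] N nonneg
        by (intro divide_left_mono) (auto simp: M_def N_def intro!: mult_pos_pos)
      also have "\<dots> \<le> (S + R * (\<epsilon> * N)) / N"
        using TS N by (intro divide_right_mono) auto
      also have "\<dots> = S / N + R * \<epsilon>"
        using N by (simp add: add_divide_distrib)
      finally show "T / M \<le> S / N + R * \<epsilon>" .
    qed
    show ?thesis
      unfolding proots using 1 2 3 by blast
  qed
qed

end
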